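(* Let $G$ be an $\mathbb{F}_q$-algebra group and let $\chi$ be an irreducible (complex) character of $G$. Then there exist an algebra subgroup $H$ of $G$ and a linear character $\lambda$ of $H$ such that $\chi = \lambda^{G}$, the character of $G$ induced from $\lambda$.
   Context: $p$ is a prime, $q=p^e$ with $e\ge 1$, and $\mathbb{F}_q$ is the field with $q$ elements. All algebras are associative with identity. An $\mathbb{F}_q$-algebra group is a group of the form $G = 1+J = \{1+a : a\in J\}$ (under multiplication), where $J=J(A)$ is the Jacobson radical of a finite dimensional $\mathbb{F}_q$-algebra $A$; it is a finite $p$-group. An algebra subgroup of $G=1+J$ is a subgroup of the form $H=1+U$ where $U$ is a multiplicatively closed $\mathbb{F}_q$-subspace of $J$. All characters are over $\mathbb{C}$; a linear character is a character of degree $1$. *)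

theory Defs
  imports "HOL-Algebra.Ideal" "Jordan_Normal_Form.VS_Connect" "HOL-Computational_Algebra.Primes"
begin

section \<open>Algebra groups\<close>

text \<open>The locale \<open>algebra\<close> of HOL-Algebra is restricted to commutative algebras,
  hence the following.\<close>

locale assoc_algebra = vectorspace F A + ring A
  for F :: "('k, 'm) ring_scheme" and A :: "('k, 'a, 'n) module_scheme" +
  assumes smult_mult_left:
      "\<lbrakk>c \<in> carrier F; x \<in> carrier A; y \<in> carrier A\<rbrakk>
        \<Longrightarrow> (c \<odot>\<^bsub>A\<^esub> x) \<otimes>\<^bsub>A\<^esub> y = c \<odot>\<^bsub>A\<^esub> (x \<otimes>\<^bsub>A\<^esub> y)"
    and smult_mult_right:
      "\<lbrakk>c \<in> carrier F; x \<in> carrier A; y \<in> carrier A\<rbrakk>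
        \<Longrightarrow> x \<otimes>\<^bsub>A\<^esub> (c \<odot>\<^bsub>A\<^esub> y) = c \<odot>\<^bsub>A\<^esub> (x \<otimes>\<^bsub>A\<^esub> y)"

locale fin_dim_algebra = assoc_algebra +
  assumes finite_dimensional: "vectorspace.fin_dim F A"

locale left_ideal = additive_subgroup I R + ring R
  for I and R :: "('a, 'b) ring_scheme" +
  assumes mult_closed: "\<lbrakk>x \<in> carrier R; a \<in> I\<rbrakk> \<Longrightarrow> x \<otimes>\<^bsub>R\<^esub> a \<in> I"

definition maximal_left_ideal :: "'a set \<Rightarrow> ('a, 'b) ring_scheme \<Rightarrow> bool" where
  "maximal_left_ideal M R \<longleftrightarrow> left_ideal M R \<and> M \<noteq> carrier R \<and>
    (\<forall>I. left_ideal I R \<and> M \<subseteq> I \<longrightarrow> I = M \<or> I = carrier R)"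

text \<open>The intersection of all maximal left ideals; for the zero ring, which has none,
  this is the whole ring.\<close>

definition jacobson_radical :: "('a, 'b) ring_scheme \<Rightarrow> 'a set" where
  "jacobson_radical R = {a \<in> carrier R. \<forall>M. maximal_left_ideal M R \<longrightarrow> a \<in> M}"

definition one_plus :: "('a, 'b) ring_scheme \<Rightarrow> 'a set \<Rightarrow> 'a set" where
  "one_plus R U = {\<one>\<^bsub>R\<^esub> \<oplus>\<^bsub>R\<^esub> a | a. a \<in> U}"

definition algebra_group :: "('a, 'b) ring_scheme \<Rightarrow> 'a monoid" where
  "algebra_group A =
    \<lparr>carrier = one_plus A (jacobson_radical A), monoid.mult = (\<otimes>\<^bsub>A\<^esub>), one = \<one>\<^bsub>A\<^esub>\<rparr>"

definition algebra_subgroup ::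
    "('k, 'm) ring_scheme \<Rightarrow> ('k, 'a, 'n) module_scheme \<Rightarrow> 'a set \<Rightarrow> bool" where
  "algebra_subgroup F A H \<longleftrightarrow> subgroup H (algebra_group A) \<and>
    (\<exists>U. subspace F U A \<and> U \<subseteq> jacobson_radical A \<and>
         (\<forall>u\<in>U. \<forall>v\<in>U. u \<otimes>\<^bsub>A\<^esub> v \<in> U) \<and> H = one_plus A U)"


section \<open>Complex characters\<close>

definition GL :: "nat \<Rightarrow> complex mat monoid" where
  "GL n = units_of (ring_mat TYPE(complex) n ())"

definition mat_trace :: "'a :: comm_monoid_add mat \<Rightarrow> 'a" where
  "mat_trace M = (\<Sum>i<dim_row M. M $$ (i, i))"

definition representation :: "('g, 'b) monoid_scheme \<Rightarrow> nat \<Rightarrow> ('g \<Rightarrow> complex mat) \<Rightarrow> bool" where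
  "representation G n \<rho> \<longleftrightarrow> \<rho> \<in> hom G (GL n)"

definition irreducible_representation ::
    "('g, 'b) monoid_scheme \<Rightarrow> nat \<Rightarrow> ('g \<Rightarrow> complex mat) \<Rightarrow> bool" where
  "irreducible_representation G n \<rho> \<longleftrightarrow> representation G n \<rho> \<and> n > 0 \<and>
    (\<forall>W. subspace class_ring W (module_vec TYPE(complex) n) \<and>
         (\<forall>g\<in>carrier G. \<forall>w\<in>W. \<rho> g *\<^sub>v w \<in> W)
         \<longrightarrow> W = {0\<^sub>v n} \<or> W = carrier_vec n)"

text \<open>Characters are functions on \<open>carrier G\<close>; their values elsewhere are irrelevant.\<close>

definition affords :: "('g, 'b) monoid_scheme \<Rightarrow> ('g \<Rightarrow> complex mat) \<Rightarrow> ('g \<Rightarrow> complex) \<Rightarrow> bool" where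
  "affords G \<rho> \<chi> \<longleftrightarrow> (\<forall>g\<in>carrier G. \<chi> g = mat_trace (\<rho> g))"

definition irreducible_character :: "('g, 'b) monoid_scheme \<Rightarrow> ('g \<Rightarrow> complex) \<Rightarrow> bool" where
  "irreducible_character G \<chi> \<longleftrightarrow>
    (\<exists>n \<rho>. irreducible_representation G n \<rho> \<and> affords G \<rho> \<chi>)"

definition linear_character :: "('g, 'b) monoid_scheme \<Rightarrow> ('g \<Rightarrow> complex) \<Rightarrow> bool" where
  "linear_character G \<chi> \<longleftrightarrow> (\<exists>\<rho>. representation G 1 \<rho> \<and> affords G \<rho> \<chi>)"

definition induced_character ::
    "('g, 'b) monoid_scheme \<Rightarrow> 'g set \<Rightarrow> ('g \<Rightarrow> complex) \<Rightarrow> 'g \<Rightarrow> complex" where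
  "induced_character G H \<psi> g =
    (\<Sum>x | x \<in> carrier G \<and> inv\<^bsub>G\<^esub> x \<otimes>\<^bsub>G\<^esub> g \<otimes>\<^bsub>G\<^esub> x \<in> H.
        \<psi> (inv\<^bsub>G\<^esub> x \<otimes>\<^bsub>G\<^esub> g \<otimes>\<^bsub>G\<^esub> x)) / of_nat (card H)"

end

theory Submission
  imports Defs "HOL-Algebra.Multiplicative_Group" "Jordan_Normal_Form.Char_Poly"
    "HOL-Computational_Algebra.Fundamental_Theorem_Algebra"
begin

text \<open>Let \<open>\<sigma>\<close> be an irreducible representation of \<open>1 + U\<close>, with \<open>U\<close> nilpotent, and let \<open>C\<close> be an
  ideal of \<open>U\<close>, maximal among those for which \<open>1 + C\<close> acts by scalars \<open>\<psi>\<close>. If \<open>C = U\<close>, then \<open>\<sigma>\<close>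
  is linear. Otherwise take \<open>y \<in> U - C\<close> with \<open>U y \<subseteq> C\<close> and \<open>y U \<subseteq> C\<close>. Commutators of \<open>1 + a\<close> and
  \<open>1 + t y\<close> act by the scalars \<open>\<psi> (a t y) / \<psi> (t y a)\<close>, which are characters of the additive group
  in \<open>a\<close>, trivial on products \<open>a = a\<^sub>1 a\<^sub>2\<close>, and unchanged when a field element is moved between
  \<open>a\<close> and \<open>y\<close>. Hence the stabilizer of an eigencharacter of \<open>1 + F y\<close> is \<open>1 + S\<close> with \<open>S\<close> a
  subalgebra, which is proper by Schur's lemma and the maximality of \<open>C\<close>. By Clifford theory \<open>\<sigma>\<close>
  is induced from an irreducible representation of \<open>1 + S\<close>, and induction on \<open>|U|\<close> applies.\<close>

text \<open>The obstacle is linearity. The stabilizer of a character under conjugation is a subgroup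
  of 1 + U, but nothing forces it to be 1 + S with S closed under addition and under the field.
  Products of p elements of J need not vanish, so exponential and logarithm cannot be relied on to
  turn commutators into Lie brackets. A group commutator in 1 + U involves inverses, and \<psi> is
  multiplicative only for the circle product c + d + c d, not for the sum. The quotient \<psi>(a b)
  / \<psi>(b a) is the way around this. The rule \<psi>(u v) = \<psi>(v u), which holds once one
  factor lies in C, works like the symmetry of a trace and absorbs every correction term caused by
  inverses and by the circle product. The conditions on y keep all products that occur inside C,
  where \<psi> is defined. Irreducibility is carried along as a condition on commuting matrices
  because in this form it passes to the range of an eigenprojection by a single averaging argument,
  with no invariant subspaces.\<close>

section \<open>Finitely supported complex matrices\<close>

text \<open>Matrices of all sizes are placed in one type, a ring without unit, so that sums over groups
  and traces need no dimension bookkeeping.\<close>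

definition mat_bound :: "nat \<Rightarrow> (nat \<Rightarrow> nat \<Rightarrow> complex) \<Rightarrow> bool" where
  "mat_bound n M \<longleftrightarrow> (\<forall>i j. n \<le> i \<or> n \<le> j \<longrightarrow> M i j = 0)"

lemma mat_bound_mono: "mat_bound n M \<Longrightarrow> n \<le> m \<Longrightarrow> mat_bound m M"
  by (auto simp: mat_bound_def)

typedef fmat = "{M :: nat \<Rightarrow> nat \<Rightarrow> complex. \<exists>n. mat_bound n M}"
  morphisms entry Abs_fmat
  by (rule exI[of _ "\<lambda>_ _. 0"]) (auto simp: mat_bound_def)

setup_lifting type_definition_fmat

lemma fmat_eqI: "(\<And>i j. entry x i j = entry y i j) \<Longrightarrow> x = y"
  by (metis entry_inject ext)

lemma fmat_bound: "\<exists>n. mat_bound n (entry x)"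
  using entry[of x] by simp

lemma fmat_bound2:
  obtains n where "mat_bound n (entry x)" "mat_bound n (entry y)"
  using fmat_bound[of x] fmat_bound[of y] mat_bound_mono by (metis nat_le_linear)

lemma fmat_bound3:
  obtains n where "mat_bound n (entry x)" "mat_bound n (entry y)" "mat_bound n (entry z)"
  using fmat_bound2[of x y] fmat_bound[of z] mat_bound_mono by (metis nat_le_linear)

instantiation fmat :: ring
begin

lift_definition zero_fmat :: fmat is "\<lambda>_ _. 0"
  by (auto simp: mat_bound_def)

lift_definition plus_fmat :: "fmat \<Rightarrow> fmat \<Rightarrow> fmat" is "\<lambda>M N i j. M i j + N i j"
proof -
  fix M N :: "nat \<Rightarrow> nat \<Rightarrow> complex"
  assume "\<exists>n. mat_bound n M" "\<exists>n. mat_bound n N"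
  then obtain m n where "mat_bound m M" "mat_bound n N" by blast
  then have "mat_bound (max m n) (\<lambda>i j. M i j + N i j)" by (auto simp: mat_bound_def)
  then show "\<exists>n. mat_bound n (\<lambda>i j. M i j + N i j)" ..
qed

lift_definition uminus_fmat :: "fmat \<Rightarrow> fmat" is "\<lambda>M i j. - M i j"
  by (auto simp: mat_bound_def)

definition "(x :: fmat) - y = x + - y"

text \<open>The support of row \<open>i\<close> of \<open>M\<close> is finite, so this sum needs no
  choice of a size; \<open>entry_times\<close> gives back the usual sum over
  \<open>k < n\<close>.\<close>

lift_definition times_fmat :: "fmat \<Rightarrow> fmat \<Rightarrow> fmat"
  is "\<lambda>M N i j. \<Sum>k | M i k \<noteq> 0. M i k * N k j"
proof -
  fix M N :: "nat \<Rightarrow> nat \<Rightarrow> complex"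
  assume "\<exists>n. mat_bound n M" "\<exists>n. mat_bound n N"
  then obtain m n where "mat_bound m M" "mat_bound n N" by blast
  then have "mat_bound (max m n) (\<lambda>i j. \<Sum>k | M i k \<noteq> 0. M i k * N k j)"
    by (auto simp: mat_bound_def intro!: sum.neutral)
  then show "\<exists>n. mat_bound n (\<lambda>i j. \<Sum>k | M i k \<noteq> 0. M i k * N k j)" ..
qed

text \<open>A term with \<open>k \<ge> n\<close> contains a vanishing factor as soon as one of the
  two matrices is bounded by \<open>n\<close>. The one-sided form later confines a product
  \<open>e * X * e\<close> to the size of \<open>e\<close>.\<close>

lemma entry_times:
  assumes "mat_bound n (entry x) \<or> mat_bound n (entry y)"
  shows "entry (x * y) i j = (\<Sum>k<n. entry x i k * entry y k j)"
proof -
  obtain m where m: "mat_bound m (entry x)" using fmat_bound by blast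
  have "entry (x * y) i j = (\<Sum>k<max m n. entry x i k * entry y k j)"
    unfolding times_fmat.rep_eq
    by (rule sum.mono_neutral_left) (use m in \<open>auto simp: mat_bound_def not_le[symmetric]\<close>)
  also have "\<dots> = (\<Sum>k<n. entry x i k * entry y k j)"
    by (rule sum.mono_neutral_right) (use assms in \<open>auto simp: mat_bound_def not_le[symmetric]\<close>)
  finally show ?thesis .
qed

instance
proof
  fix a b c :: fmat
  show "a + b + c = a + (b + c)" by transfer (simp add: ac_simps)
  show "a + b = b + a" by transfer (simp add: ac_simps)
  show "0 + a = a" by transfer simp
  show "- a + a = 0" by transfer simp
  show "a - b = a + - b" by (rule minus_fmat_def)
  obtain n where n: "mat_bound n (entry a)" "mat_bound n (entry b)" "mat_bound n (entry c)"
    by (rule fmat_bound3)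
  have m: "entry (a * b) i j = (\<Sum>k<n. entry a i k * entry b k j)"
    "entry (b * c) i j = (\<Sum>k<n. entry b i k * entry c k j)"
    "entry (a * b * c) i j = (\<Sum>k<n. entry (a * b) i k * entry c k j)"
    "entry (a * (b * c)) i j = (\<Sum>k<n. entry a i k * entry (b * c) k j)" for i j
    using n by (auto intro!: entry_times)
  show "a * b * c = a * (b * c)"
  proof (rule fmat_eqI)
    fix i j
    have "entry (a * b * c) i j = (\<Sum>k<n. \<Sum>l<n. entry a i l * entry b l k * entry c k j)"
      by (simp add: m sum_distrib_right)
    also have "\<dots> = (\<Sum>l<n. \<Sum>k<n. entry a i l * entry b l k * entry c k j)"
      by (rule sum.swap)
    also have "\<dots> = entry (a * (b * c)) i j"
      by (simp add: m sum_distrib_left mult.assoc)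
    finally show "entry (a * b * c) i j = entry (a * (b * c)) i j" .
  qed
  have ac: "entry (a * c) i j = (\<Sum>k<n. entry a i k * entry c k j)"
    "entry ((a + b) * c) i j = (\<Sum>k<n. entry (a + b) i k * entry c k j)"
    "entry (a * (b + c)) i j = (\<Sum>k<n. entry a i k * entry (b + c) k j)" for i j
    using n by (auto intro!: entry_times)
  show "(a + b) * c = a * c + b * c"
    by (rule fmat_eqI) (simp add: ac m plus_fmat.rep_eq distrib_right sum.distrib)
  show "a * (b + c) = a * b + a * c"
    by (rule fmat_eqI) (simp add: ac m plus_fmat.rep_eq distrib_left sum.distrib)
qed

end

lift_definition fscale :: "complex \<Rightarrow> fmat \<Rightarrow> fmat" (infixr "\<cdot>\<^sub>f" 75) is "\<lambda>c M i j. c * M i j"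
  by (force simp: mat_bound_def)

lift_definition funit :: "nat \<Rightarrow> nat \<Rightarrow> fmat" is "\<lambda>i j k l. if k = i \<and> l = j then 1 else 0"
proof -
  fix i j
  have "mat_bound (Suc (max i j)) (\<lambda>k l. if k = i \<and> l = j then 1 else 0)"
    by (auto simp: mat_bound_def)
  then show "\<exists>n. mat_bound n (\<lambda>k l. if k = i \<and> l = j then 1 else 0)" ..
qed

definition ftrace :: "fmat \<Rightarrow> complex" where
  "ftrace x = (\<Sum>i | entry x i i \<noteq> 0. entry x i i)"

lemma ftrace_bound:
  assumes "mat_bound n (entry x)"
  shows "ftrace x = (\<Sum>i<n. entry x i i)"
  unfolding ftrace_def
  by (rule sum.mono_neutral_left) (use assms in \<open>auto simp: mat_bound_def not_le[symmetric]\<close>)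

lemma fscale_simps [simp]:
  "c \<cdot>\<^sub>f d \<cdot>\<^sub>f x = (c * d) \<cdot>\<^sub>f x" "1 \<cdot>\<^sub>f x = x" "0 \<cdot>\<^sub>f x = 0" "c \<cdot>\<^sub>f 0 = 0"
  by (transfer; simp add: mult.assoc)+

lemma fscale_add: "c \<cdot>\<^sub>f (x + y) = c \<cdot>\<^sub>f x + c \<cdot>\<^sub>f y"
  by transfer (simp add: distrib_left)

lemma fscale_add_left: "(c + d) \<cdot>\<^sub>f x = c \<cdot>\<^sub>f x + d \<cdot>\<^sub>f x"
  by transfer (simp add: distrib_right)

lemma fscale_sum: "c \<cdot>\<^sub>f sum f I = (\<Sum>i\<in>I. c \<cdot>\<^sub>f f i)"
  by (induction I rule: infinite_finite_induct) (auto simp: fscale_add)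

lemma fscale_sum_left: "sum f I \<cdot>\<^sub>f x = (\<Sum>i\<in>I. f i \<cdot>\<^sub>f x)"
  by (induction I rule: infinite_finite_induct) (auto simp: fscale_add_left)

lemma fscale_times [simp]: "(c \<cdot>\<^sub>f x) * y = c \<cdot>\<^sub>f (x * y)" "x * (c \<cdot>\<^sub>f y) = c \<cdot>\<^sub>f (x * y)"
proof -
  obtain n where n: "mat_bound n (entry x)" "mat_bound n (entry y)"
    using fmat_bound2 by blast
  then have "mat_bound n (entry (c \<cdot>\<^sub>f x))" "mat_bound n (entry (c \<cdot>\<^sub>f y))"
    by (auto simp: fscale.rep_eq mat_bound_def)
  with n have e: "entry (x * y) i j = (\<Sum>k<n. entry x i k * entry y k j)"
    "entry ((c \<cdot>\<^sub>f x) * y) i j = (\<Sum>k<n. entry (c \<cdot>\<^sub>f x) i k * entry y k j)"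
    "entry (x * (c \<cdot>\<^sub>f y)) i j = (\<Sum>k<n. entry x i k * entry (c \<cdot>\<^sub>f y) k j)" for i j
    using entry_times by blast+
  show "(c \<cdot>\<^sub>f x) * y = c \<cdot>\<^sub>f (x * y)" "x * (c \<cdot>\<^sub>f y) = c \<cdot>\<^sub>f (x * y)"
    by (auto intro!: fmat_eqI simp: e fscale.rep_eq sum_distrib_left ac_simps)
qed

lemma fscale_eq_0_iff [simp]: "c \<cdot>\<^sub>f x = 0 \<longleftrightarrow> c = 0 \<or> x = 0"
  by (auto simp: fun_eq_iff fscale.rep_eq zero_fmat.rep_eq entry_inject[symmetric])

lemma fscale_cancel: "x \<noteq> 0 \<Longrightarrow> c \<cdot>\<^sub>f x = d \<cdot>\<^sub>f x \<longleftrightarrow> c = d"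
  by (auto simp: fun_eq_iff fscale.rep_eq zero_fmat.rep_eq entry_inject[symmetric])

lemma ftrace_0 [simp]: "ftrace 0 = 0"
  by (simp add: ftrace_def zero_fmat.rep_eq)

lemma ftrace_add: "ftrace (x + y) = ftrace x + ftrace y"
proof -
  obtain n where n: "mat_bound n (entry x)" "mat_bound n (entry y)"
    using fmat_bound2 by blast
  then have "mat_bound n (entry (x + y))"
    by (auto simp: plus_fmat.rep_eq mat_bound_def)
  with n show ?thesis by (simp add: ftrace_bound plus_fmat.rep_eq sum.distrib)
qed

lemma ftrace_sum: "ftrace (sum f I) = (\<Sum>i\<in>I. ftrace (f i))"
  by (induction I rule: infinite_finite_induct) (auto simp: ftrace_add)

lemma ftrace_scale: "ftrace (c \<cdot>\<^sub>f x) = c * ftrace x"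
proof -
  obtain n where n: "mat_bound n (entry x)"
    using fmat_bound by blast
  then have "mat_bound n (entry (c \<cdot>\<^sub>f x))"
    by (auto simp: fscale.rep_eq mat_bound_def)
  with n show ?thesis by (simp add: ftrace_bound fscale.rep_eq sum_distrib_left)
qed

lemma mat_bound_times:
  assumes "mat_bound n (entry x)" "mat_bound n (entry y)"
  shows "mat_bound n (entry (x * y))"
proof -
  have e: "entry (x * y) i j = (\<Sum>k<n. entry x i k * entry y k j)" for i j
    using assms by (intro entry_times) auto
  show ?thesis
    using assms by (auto simp: mat_bound_def e intro!: sum.neutral)
qed

lemma ftrace_commute: "ftrace (x * y) = ftrace (y * x)"
proof -
  obtain n where n: "mat_bound n (entry x)" "mat_bound n (entry y)"
    using fmat_bound2 by blast
  have e: "entry (x * y) i j = (\<Sum>k<n. entry x i k * entry y k j)"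
    "entry (y * x) i j = (\<Sum>k<n. entry y i k * entry x k j)" for i j
    using n by (auto intro!: entry_times)
  have "ftrace (x * y) = (\<Sum>i<n. \<Sum>k<n. entry x i k * entry y k i)"
    by (simp add: ftrace_bound[OF mat_bound_times[OF n]] e)
  also have "\<dots> = (\<Sum>k<n. \<Sum>i<n. entry x i k * entry y k i)"
    by (rule sum.swap)
  also have "\<dots> = ftrace (y * x)"
    by (simp add: ftrace_bound[OF mat_bound_times[OF n(2,1)]] e mult.commute)
  finally show ?thesis .
qed

text \<open>A matrix unit in the middle picks out column \<open>i\<close> of \<open>x\<close> and
  row \<open>j\<close> of \<open>y\<close>. This turns minimality of an idempotent into relations
  between its entries.\<close>

lemma entry_funit_times: "entry (x * funit i j * y) k l = entry x k i * entry y j l"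
proof -
  obtain m where m: "mat_bound m (entry x)" "mat_bound m (entry y)" "mat_bound m (entry (funit i j))"
    using fmat_bound3 by blast
  define n where "n = max m (Suc (max i j))"
  have n: "mat_bound n (entry x)" "mat_bound n (entry y)" and ij: "i < n" "j < n"
    using m mat_bound_mono[of m _ n] by (auto simp: n_def)
  have u: "entry (x * funit i j) k a = (if a = j then entry x k i else 0)" for a
  proof -
    have "entry (x * funit i j) k a = (\<Sum>b<n. if b = i then (if a = j then entry x k i else 0) else 0)"
      by (simp add: entry_times[OF disjI1, OF n(1)] funit.rep_eq if_distrib cong: if_cong)
        (auto intro!: sum.cong)
    then show ?thesis using ij by simp
  qed
  have "entry (x * funit i j * y) k l = (\<Sum>a<n. if a = j then entry x k i * entry y j l else 0)"
    by (simp add: entry_times[OF disjI2, OF n(2)] u if_distrib if_distribR cong: if_cong)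
  then show ?thesis using ij by simp
qed

text \<open>From \<open>e E\<^sub>i\<^sub>j e = c\<^sub>i\<^sub>j e\<close> all rows of \<open>e\<close> are proportional, so \<open>e\<close> has rank one.\<close>

lemma ftrace_minimal_idempotent:
  assumes "e * e = e" "e \<noteq> 0" and min: "\<And>M. e * M * e = M \<Longrightarrow> \<exists>c. M = c \<cdot>\<^sub>f e"
  shows "ftrace e = 1"
proof -
  have "\<exists>c. e * M * e = c \<cdot>\<^sub>f e" for M
    by (rule min) (metis assms(1) mult.assoc)
  then have "\<exists>c. \<forall>k l. entry e k i * entry e j l = c * entry e k l" for i j
    by (metis entry_funit_times fscale.rep_eq)
  then obtain c where c: "\<And>i j k l. entry e k i * entry e j l = c i j * entry e k l"
    by metis
  obtain n where n: "mat_bound n (entry e)" using fmat_bound by blast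
  have ee: "(\<Sum>k<n. entry e i k * entry e k j) = entry e i j" for i j
    using entry_times[of n e e i j] n assms(1) by simp
  from assms(2) obtain j i where ji: "entry e j i \<noteq> 0"
    by (metis fmat_eqI zero_fmat.rep_eq)
  \<comment> \<open>Put \<open>l = k\<close> in \<open>c\<close> and sum over \<open>k\<close>: the
    left side becomes an entry of \<open>e * e = e\<close>, and the right side contains the
    trace.\<close>
  have tr: "ftrace e * c i j = entry e j i"
  proof -
    have "ftrace e * c i j = (\<Sum>k<n. entry e j k * entry e k i)"
      using n by (simp add: ftrace_bound sum_distrib_left sum_distrib_right c mult.commute)
    then show ?thesis using ee by simp
  qed
  have "c i j * entry e j i = entry e j i * entry e j i"
    using c[of j i j i] by metis
  then have "c i j = entry e j i" using ji by simp
  with tr ji show ?thesis by simp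
qed

section \<open>Irreducible representations and induced characters\<close>

text \<open>Representations are modelled as multiplicative maps \<open>\<sigma>\<close> into \<open>fmat\<close>, with the idempotent
  \<open>\<sigma> \<one>\<close> as the identity; irreducibility is expressed by Schur's condition on the commutant.\<close>

definition irreducible_fmat_rep :: "('g, 'b) monoid_scheme \<Rightarrow> ('g \<Rightarrow> fmat) \<Rightarrow> bool" where
  "irreducible_fmat_rep G \<sigma> \<longleftrightarrow>
    (\<forall>x\<in>carrier G. \<forall>y\<in>carrier G. \<sigma> (x \<otimes>\<^bsub>G\<^esub> y) = \<sigma> x * \<sigma> y) \<and> \<sigma> \<one>\<^bsub>G\<^esub> \<noteq> 0 \<and>
    (\<forall>M. \<sigma> \<one>\<^bsub>G\<^esub> * M * \<sigma> \<one>\<^bsub>G\<^esub> = M \<longrightarrow> (\<forall>g\<in>carrier G. M * \<sigma> g = \<sigma> g * M) \<longrightarrow>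
      (\<exists>c. M = c \<cdot>\<^sub>f \<sigma> \<one>\<^bsub>G\<^esub>))"

section \<open>Eigenprojections of commuting matrices of finite order\<close>

text \<open>Exchanging the roles of \<open>j\<close> and \<open>k\<close> makes the sum geometric:
  the \<open>k\<close>-th power of the \<open>j\<close>-th root is \<open>z ^ j\<close>, and
  \<open>z = 1\<close> exactly when \<open>m dvd k\<close>.\<close>

lemma sum_root_of_unity_powers:
  assumes "m > 0"
  shows "(\<Sum>j<m. cis (2 * pi * real j / real m) ^ k) = (if m dvd k then of_nat m else 0)"
proof -
  define z where "z = cis (2 * pi * real k / real m)"
  have "cis (2 * pi * real j / real m) ^ k = z ^ j" for j
    by (simp add: z_def DeMoivre ac_simps)
  then have s: "(\<Sum>j<m. cis (2 * pi * real j / real m) ^ k) = (\<Sum>j<m. z ^ j)"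
    by simp
  have zm: "z ^ m = 1"
    using assms by (simp add: z_def DeMoivre cis_multiple_2pi)
  have "z = 1 \<longleftrightarrow> m dvd k"
  proof
    assume "z = 1"
    then have "cos (2 * pi * real k / real m) = 1"
      by (simp add: z_def complex_eq_iff)
    then obtain i :: int where "2 * pi * real k / real m = of_int i * 2 * pi"
      by (auto simp: cos_one_2pi_int)
    then have "real k = real_of_int (i * int m)"
      using assms by (simp add: field_simps)
    then have "int k = i * int m"
      using of_int_eq_iff by fastforce
    then show "m dvd k"
      by (metis dvd_triv_right int_dvd_int_iff)
  next
    assume "m dvd k"
    then obtain i where "k = m * i" ..
    then have "2 * pi * real k / real m = 2 * pi * real i"
      using assms by simp
    then show "z = 1"
      unfolding z_def by (simp only: cis_multiple_2pi Ints_of_nat)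
  qed
  then show ?thesis
    using zm by (auto simp: s geometric_sum)
qed

text \<open>Decomposition of the unit \<open>a 0\<close> under a cyclic group \<open>a\<close> of order \<open>m\<close>: the elements
  \<open>p \<zeta> = m\<^sup>-\<^sup>1 (\<Sum>k<m. \<zeta>\<^sup>-\<^sup>k a k)\<close> with \<open>\<zeta>\<^sup>m = 1\<close> are eigenprojections and add up to \<open>a 0\<close>.\<close>

lemma cyclic_eigenprojection:
  fixes a :: "nat \<Rightarrow> fmat"
  assumes m: "m > 0" and add: "\<And>k l. a (k + l) = a k * a l" and am: "a m = a 0"
    and e: "e \<noteq> 0" "a 0 * e = e"
  shows "\<exists>p c. p * p = p \<and> p * e \<noteq> 0 \<and> a 1 * p = c \<cdot>\<^sub>f p \<and> a 0 * p = p \<and>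
    (\<forall>M. M * a 0 = a 0 * M \<longrightarrow> M * a 1 = a 1 * M \<longrightarrow> M * p = p * M)"
proof -
  define w where "w j = cis (2 * pi * real j / real m)" for j
  define p where "p j = (1 / of_nat m) \<cdot>\<^sub>f (\<Sum>k<m. (1 / w j ^ k) \<cdot>\<^sub>f a k)" for j
  have w0 [simp]: "w j \<noteq> 0" for j by (simp add: w_def)
  have wm: "w j ^ m = 1" for j
    using m by (simp add: w_def DeMoivre cis_multiple_2pi)
  have a1p: "a 1 * p j = w j \<cdot>\<^sub>f p j" for j
  proof -
    have "(\<Sum>k<m. (1 / w j ^ k) \<cdot>\<^sub>f a (Suc k)) = w j \<cdot>\<^sub>f (\<Sum>k<m. (1 / w j ^ Suc k) \<cdot>\<^sub>f a (Suc k))"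
      by (simp add: fscale_sum)
    \<comment> \<open>The shift of the index is cyclic. The sum over \<open>k < Suc m\<close> is
      split once at its first and once at its last term, and both of these are \<open>a 0\<close>
      since \<open>a m = a 0\<close> and \<open>w j ^ m = 1\<close>.\<close>
    also have "(\<Sum>k<m. (1 / w j ^ Suc k) \<cdot>\<^sub>f a (Suc k)) = (\<Sum>k<m. (1 / w j ^ k) \<cdot>\<^sub>f a k)"
    proof -
      have "(\<Sum>k<Suc m. (1 / w j ^ k) \<cdot>\<^sub>f a k) = a 0 + (\<Sum>k<m. (1 / w j ^ Suc k) \<cdot>\<^sub>f a (Suc k))"
        by (subst sum.lessThan_Suc_shift) simp
      moreover have "(\<Sum>k<Suc m. (1 / w j ^ k) \<cdot>\<^sub>f a k) = (\<Sum>k<m. (1 / w j ^ k) \<cdot>\<^sub>f a k) + a 0"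
        by (simp add: wm am)
      ultimately show ?thesis by (simp add: add.commute)
    qed
    finally have e: "(\<Sum>k<m. (1 / w j ^ k) \<cdot>\<^sub>f a (Suc k)) = w j \<cdot>\<^sub>f (\<Sum>k<m. (1 / w j ^ k) \<cdot>\<^sub>f a k)" .
    have aS: "a 1 * a k = a (Suc k)" for k using add[of 1 k] by simp
    have "a 1 * p j = (1 / of_nat m) \<cdot>\<^sub>f (\<Sum>k<m. (1 / w j ^ k) \<cdot>\<^sub>f (a 1 * a k))"
      unfolding p_def sum_distrib_left fscale_times ..
    then show ?thesis
      unfolding aS e p_def by (simp add: mult.commute)
  qed
  have a0a: "a 0 * a k = a k" for k using add[of 0 k] by simp
  have a0p: "a 0 * p j = p j" for j
    by (simp add: p_def sum_distrib_left a0a)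
  have akp: "a k * p j = w j ^ k \<cdot>\<^sub>f p j" for k j
  proof (induction k)
    case (Suc k)
    have "a (Suc k) * p j = a 1 * (a k * p j)" using add[of 1 k] by (simp add: mult.assoc)
    then show ?case using Suc a1p by (simp add: mult.commute)
  qed (simp add: a0p)
  have pp: "p j * p j = p j" for j
  proof -
    have "p j * x = (1 / of_nat m) \<cdot>\<^sub>f (\<Sum>k<m. (1 / w j ^ k) \<cdot>\<^sub>f (a k * x))" for x
      by (simp add: p_def sum_distrib_right)
    then have "p j * p j = (1 / of_nat m) \<cdot>\<^sub>f (\<Sum>k<m. (1 / w j ^ k) \<cdot>\<^sub>f (a k * p j))" .
    also have "\<dots> = (1 / of_nat m) \<cdot>\<^sub>f (\<Sum>k<m. 1) \<cdot>\<^sub>f p j"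
      by (subst fscale_sum_left) (simp add: akp)
    finally show ?thesis using m by simp
  qed
  have sp: "(\<Sum>j<m. p j) = a 0"
  proof -
    have inv: "(\<Sum>j<m. 1 / w j ^ k) = (if k = 0 then of_nat m else 0)" if "k < m" for k
    proof -
      have "1 / w j ^ k = w j ^ (m - k)" for j
        using that wm[of j] by (simp add: field_simps power_add[symmetric])
      then have "(\<Sum>j<m. 1 / w j ^ k) = (\<Sum>j<m. w j ^ (m - k))" by simp
      also have "\<dots> = (if m dvd m - k then of_nat m else 0)"
        unfolding w_def by (rule sum_root_of_unity_powers[OF m])
      also have "m dvd m - k \<longleftrightarrow> k = 0"
        using that m by (auto dest: dvd_imp_le)
      finally show ?thesis .
    qed
    have "(\<Sum>j<m. p j) = (1 / of_nat m) \<cdot>\<^sub>f (\<Sum>j<m. \<Sum>k<m. (1 / w j ^ k) \<cdot>\<^sub>f a k)"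
      by (simp add: p_def fscale_sum)
    also have "(\<Sum>j<m. \<Sum>k<m. (1 / w j ^ k) \<cdot>\<^sub>f a k) = (\<Sum>k<m. (\<Sum>j<m. 1 / w j ^ k) \<cdot>\<^sub>f a k)"
      by (subst sum.swap) (simp add: fscale_sum_left)
    also have "\<dots> = (\<Sum>k<m. if k = 0 then of_nat m \<cdot>\<^sub>f a 0 else 0)"
      by (rule sum.cong) (auto simp: inv)
    finally show ?thesis using m by simp
  qed
  have "\<exists>j. p j * e \<noteq> 0"
  proof (rule ccontr)
    assume "\<nexists>j. p j * e \<noteq> 0"
    then have "(\<Sum>j<m. p j) * e = 0" by (simp add: sum_distrib_right)
    then show False using sp e by simp
  qed
  then obtain j where j: "p j * e \<noteq> 0" ..
  have comm: "M * p j = p j * M" if M: "M * a 0 = a 0 * M" "M * a 1 = a 1 * M" for M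
  proof -
    have "M * a k = a k * M" for k
    proof (induction k)
      case (Suc k)
      have "M * (a k * a 1) = a k * a 1 * M"
        using Suc M(2) by (metis mult.assoc)
      then show ?case using add[of k 1] by simp
    qed (rule M)
    then show ?thesis
      by (simp add: p_def sum_distrib_left sum_distrib_right)
  qed
  show ?thesis
    using pp a1p a0p j comm by blast
qed

text \<open>One element of \<open>N\<close> is added at a time: an eigenprojection \<open>q\<close>
  of the new element is chosen with \<open>q * p \<noteq> 0\<close>, and \<open>q * p\<close>
  replaces \<open>p\<close>. The last clause, a substitute for membership of \<open>p\<close> in the
  algebra generated by the \<open>\<sigma> n\<close>, makes \<open>q\<close> and \<open>p\<close>
  commute and later lets \<open>p\<close> commute with the stabilizer. \<open>N\<close> is a mere
  set because \<open>1 + F y\<close> is in general not closed under multiplication.\<close>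

lemma (in group) common_eigenprojection:
  fixes \<sigma> :: "'a \<Rightarrow> fmat"
  assumes fin: "finite (carrier G)"
    and hom: "\<And>x y. x \<in> carrier G \<Longrightarrow> y \<in> carrier G \<Longrightarrow> \<sigma> (x \<otimes> y) = \<sigma> x * \<sigma> y"
    and nz: "\<sigma> \<one> \<noteq> 0"
    and N: "N \<subseteq> carrier G"
    and comm: "\<And>x y. x \<in> N \<Longrightarrow> y \<in> N \<Longrightarrow> \<sigma> x * \<sigma> y = \<sigma> y * \<sigma> x"
  shows "\<exists>p c. p \<noteq> 0 \<and> p * p = p \<and> \<sigma> \<one> * p = p \<and> (\<forall>n\<in>N. \<sigma> n * p = c n \<cdot>\<^sub>f p) \<and>
    (\<forall>M. M * \<sigma> \<one> = \<sigma> \<one> * M \<longrightarrow> (\<forall>n\<in>N. M * \<sigma> n = \<sigma> n * M) \<longrightarrow> M * p = p * M)"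
proof -
  have "finite N" using fin N finite_subset by blast
  then show ?thesis using N comm
  proof (induction N rule: finite_induct)
    case empty
    then show ?case using nz hom[of \<one> \<one>] by (intro exI[of _ "\<sigma> \<one>"]) auto
  next
    case (insert n N)
    have "N \<subseteq> carrier G" using insert.prems by simp
    moreover have "\<sigma> x * \<sigma> y = \<sigma> y * \<sigma> x" if "x \<in> N" "y \<in> N" for x y
      using that by (intro insert.prems) auto
    ultimately obtain p c where p: "p \<noteq> 0" "p * p = p" "\<sigma> \<one> * p = p" "\<forall>n\<in>N. \<sigma> n * p = c n \<cdot>\<^sub>f p"
      and dc: "\<And>M. M * \<sigma> \<one> = \<sigma> \<one> * M \<Longrightarrow> (\<forall>n\<in>N. M * \<sigma> n = \<sigma> n * M) \<Longrightarrow> M * p = p * M"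
      using insert.IH by blast
    have n: "n \<in> carrier G" using insert by simp
    \<comment> \<open>The order of the group serves as a common period, so the order of the single
      element \<open>n\<close> does not have to be determined.\<close>
    define a where "a k = \<sigma> (n [^] k)" for k :: nat
    have a01: "a 0 = \<sigma> \<one>" "a 1 = \<sigma> n" using n by (auto simp: a_def)
    have "\<exists>q d. q * q = q \<and> q * p \<noteq> 0 \<and> a 1 * q = d \<cdot>\<^sub>f q \<and> a 0 * q = q \<and>
      (\<forall>M. M * a 0 = a 0 * M \<longrightarrow> M * a 1 = a 1 * M \<longrightarrow> M * q = q * M)"
    proof (rule cyclic_eigenprojection)
      show "Coset.order G > 0" using fin by (simp add: order_gt_0_iff_finite)
      show "a (k + l) = a k * a l" for k l
        using n by (simp add: a_def nat_pow_mult[symmetric] hom)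
      show "a (Coset.order G) = a 0" using n by (simp add: a_def pow_order_eq_1)
      show "p \<noteq> 0" by fact
      show "a 0 * p = p" using p a01 by simp
    qed
    then obtain q d where q: "q * q = q" "q * p \<noteq> 0" "\<sigma> n * q = d \<cdot>\<^sub>f q" "\<sigma> \<one> * q = q"
      and dq: "\<And>M. M * \<sigma> \<one> = \<sigma> \<one> * M \<Longrightarrow> M * \<sigma> n = \<sigma> n * M \<Longrightarrow> M * q = q * M"
      unfolding a01 by blast
    have one: "\<sigma> \<one> * \<sigma> x = \<sigma> x" "\<sigma> x * \<sigma> \<one> = \<sigma> x" if "x \<in> carrier G" for x
      using that hom[of \<one> x] hom[of x \<one>] by auto
    \<comment> \<open>The commutant clause is used twice: for the old \<open>p\<close> with
      \<open>M = \<sigma> x\<close>, and then for \<open>q\<close> with \<open>M = p\<close>, which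
      gives \<open>p * q = q * p\<close>.\<close>
    have "\<sigma> x * p = p * \<sigma> x" if "x \<in> insert n N" for x
      using that insert.prems by (intro dc) (auto simp: one)
    then have pn: "p * \<sigma> n = \<sigma> n * p" by simp
    have p1: "p * \<sigma> \<one> = \<sigma> \<one> * p" by (rule dc[symmetric]) (use insert.prems one in auto)
    have pq: "p * q = q * p" by (rule dq) (simp_all add: pn p1)
    show ?case
    proof (intro exI conjI ballI allI impI)
      show "q * p \<noteq> 0" by fact
      show "q * p * (q * p) = q * p" using pq p q by (metis mult.assoc)
      show "\<sigma> \<one> * (q * p) = q * p" using q by (simp add: mult.assoc[symmetric])
      show "\<sigma> x * (q * p) = (c(n := d)) x \<cdot>\<^sub>f (q * p)" if "x \<in> insert n N" for x
      proof (cases "x = n")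
        case True
        then show ?thesis using q by (simp add: mult.assoc[symmetric])
      next
        case False
        then have "\<sigma> x * p = c x \<cdot>\<^sub>f p" using that p by auto
        then have "\<sigma> x * (p * q) = c x \<cdot>\<^sub>f (p * q)" by (simp add: mult.assoc[symmetric])
        then show ?thesis using False pq by simp
      qed
      show "M * (q * p) = q * p * M"
        if "M * \<sigma> \<one> = \<sigma> \<one> * M" "\<forall>n\<in>insert n N. M * \<sigma> n = \<sigma> n * M" for M
      proof -
        have "M * p = p * M" using that by (intro dc) auto
        moreover have "M * q = q * M" using that by (intro dq) auto
        ultimately show ?thesis by (metis mult.assoc)
      qed
    qed
  qed
qed

section \<open>Transitivity of induction and the Clifford correspondence\<close>

lemma (in group) induced_character_eq:
  assumes "finite (carrier G)"
  shows "induced_character G H \<psi> g =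
    (\<Sum>x\<in>carrier G. if inv x \<otimes> g \<otimes> x \<in> H then \<psi> (inv x \<otimes> g \<otimes> x) else 0) / of_nat (card H)"
  unfolding induced_character_def using assms
  by (simp add: sum.inter_filter[symmetric] Int_def[symmetric] conj_commute)

lemma (in group) induced_character_cong:
  assumes "\<And>h. h \<in> H \<Longrightarrow> \<psi> h = \<psi>' h"
  shows "induced_character G H \<psi> g = induced_character G H \<psi>' g"
  unfolding induced_character_def using assms by (auto intro!: sum.cong)

text \<open>Unfolding both inductions leaves a double sum over \<open>x\<close> in \<open>G\<close>
  and \<open>h\<close> in \<open>H\<close> of the zero extension \<open>F\<close> of
  \<open>\<psi>\<close>, taken at the conjugate of \<open>g\<close> by \<open>x \<otimes> h\<close>.
  Right translation by \<open>h\<close> permutes \<open>G\<close>, so all \<open>h\<close>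
  contribute equally and the factor \<open>card H\<close> cancels.\<close>

lemma (in group) induced_character_trans:
  assumes fin: "finite (carrier G)" and H: "subgroup H G" and K: "K \<subseteq> H"
    and g: "g \<in> carrier G"
  shows "induced_character G H (induced_character (G\<lparr>carrier := H\<rparr>) K \<psi>) g
    = induced_character G K \<psi> g"
proof -
  interpret H: group "G\<lparr>carrier := H\<rparr>" using H by (rule subgroup_imp_group)
  have HG: "H \<subseteq> carrier G" using H by (rule subgroup.subset)
  then have finH: "finite H" using fin finite_subset by blast
  define F where "F y = (if y \<in> K then \<psi> y else 0)" for y
  have inv: "inv\<^bsub>G\<lparr>carrier := H\<rparr>\<^esub> h = inv h" if "h \<in> H" for h
    using that H by (simp add: m_inv_consistent)
  have indH: "induced_character (G\<lparr>carrier := H\<rparr>) K \<psi> y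
      = (\<Sum>h\<in>H. F (inv h \<otimes> y \<otimes> h)) / of_nat (card K)" for y
    using finH by (subst H.induced_character_eq) (auto simp: F_def inv intro!: sum.cong)
  have eq: "(if inv x \<otimes> g \<otimes> x \<in> H then F (inv h \<otimes> (inv x \<otimes> g \<otimes> x) \<otimes> h) else 0)
      = F (inv (x \<otimes> h) \<otimes> g \<otimes> (x \<otimes> h))" if x: "x \<in> carrier G" and h: "h \<in> H" for x h
  proof -
    have h': "h \<in> carrier G" using h HG by auto
    have e: "inv h \<otimes> (inv x \<otimes> g \<otimes> x) \<otimes> h = inv (x \<otimes> h) \<otimes> g \<otimes> (x \<otimes> h)"
      using x h' g by (simp add: m_assoc inv_mult_group)
    have "inv x \<otimes> g \<otimes> x \<in> H" if "inv h \<otimes> (inv x \<otimes> g \<otimes> x) \<otimes> h \<in> H"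
    proof -
      have "h \<otimes> (inv h \<otimes> (inv x \<otimes> g \<otimes> x) \<otimes> h) \<otimes> inv h \<in> H"
        using that h H by (simp add: subgroup.m_closed subgroup.m_inv_closed)
      moreover have "h \<otimes> (inv h \<otimes> z \<otimes> h) \<otimes> inv h = z" if z: "z \<in> carrier G" for z
      proof -
        have "h \<otimes> (inv h \<otimes> z \<otimes> h) \<otimes> inv h = (h \<otimes> inv h) \<otimes> z \<otimes> (h \<otimes> inv h)"
          using h' z by (simp only: m_assoc m_closed inv_closed)
        then show ?thesis using h' z by simp
      qed
      ultimately show ?thesis using x g by simp
    qed
    then show ?thesis using K by (auto simp: F_def e)
  qed
  have "(\<Sum>x\<in>carrier G. if inv x \<otimes> g \<otimes> x \<in> H
        then (\<Sum>h\<in>H. F (inv h \<otimes> (inv x \<otimes> g \<otimes> x) \<otimes> h)) / of_nat (card K) else 0)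
      = (\<Sum>x\<in>carrier G. \<Sum>h\<in>H. F (inv (x \<otimes> h) \<otimes> g \<otimes> (x \<otimes> h)) / of_nat (card K))"
  proof (rule sum.cong[OF refl])
    fix x assume x: "x \<in> carrier G"
    have "(if inv x \<otimes> g \<otimes> x \<in> H
        then (\<Sum>h\<in>H. F (inv h \<otimes> (inv x \<otimes> g \<otimes> x) \<otimes> h)) / of_nat (card K) else 0)
      = (\<Sum>h\<in>H. (if inv x \<otimes> g \<otimes> x \<in> H then F (inv h \<otimes> (inv x \<otimes> g \<otimes> x) \<otimes> h) else 0) / of_nat (card K))"
      by (cases "inv x \<otimes> g \<otimes> x \<in> H") (simp_all only: if_True if_False sum_divide_distrib div_0 sum.neutral_const)
    also have "\<dots> = (\<Sum>h\<in>H. F (inv (x \<otimes> h) \<otimes> g \<otimes> (x \<otimes> h)) / of_nat (card K))"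
      by (rule sum.cong[OF refl]) (simp only: eq[OF x])
    finally show "(if inv x \<otimes> g \<otimes> x \<in> H
        then (\<Sum>h\<in>H. F (inv h \<otimes> (inv x \<otimes> g \<otimes> x) \<otimes> h)) / of_nat (card K) else 0)
      = (\<Sum>h\<in>H. F (inv (x \<otimes> h) \<otimes> g \<otimes> (x \<otimes> h)) / of_nat (card K))" .
  qed
  also have "\<dots> = (\<Sum>h\<in>H. \<Sum>x\<in>carrier G. F (inv (x \<otimes> h) \<otimes> g \<otimes> (x \<otimes> h)) / of_nat (card K))"
    by (rule sum.swap)
  also have "\<dots> = (\<Sum>h\<in>H. \<Sum>x\<in>carrier G. F (inv x \<otimes> g \<otimes> x) / of_nat (card K))"
  proof (rule sum.cong[OF refl])
    fix h assume "h \<in> H"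
    then have h: "h \<in> carrier G" using HG by auto
    have "bij_betw (\<lambda>x. x \<otimes> h) (carrier G) (carrier G)"
      by (rule bij_betwI[where g = "\<lambda>x. x \<otimes> inv h"]) (use h in \<open>auto simp: m_assoc\<close>)
    then show "(\<Sum>x\<in>carrier G. F (inv (x \<otimes> h) \<otimes> g \<otimes> (x \<otimes> h)) / of_nat (card K))
        = (\<Sum>x\<in>carrier G. F (inv x \<otimes> g \<otimes> x) / of_nat (card K))"
      by (rule sum.reindex_bij_betw)
  qed
  also have "\<dots> = of_nat (card H) * (\<Sum>x\<in>carrier G. F (inv x \<otimes> g \<otimes> x) / of_nat (card K))"
    by simp
  finally have sum_eq: "(\<Sum>x\<in>carrier G. if inv x \<otimes> g \<otimes> x \<in> H
        then (\<Sum>h\<in>H. F (inv h \<otimes> (inv x \<otimes> g \<otimes> x) \<otimes> h)) / of_nat (card K) else 0)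
      = of_nat (card H) * (\<Sum>x\<in>carrier G. F (inv x \<otimes> g \<otimes> x) / of_nat (card K))" .
  have "induced_character G H (induced_character (G\<lparr>carrier := H\<rparr>) K \<psi>) g
      = of_nat (card H) * (\<Sum>x\<in>carrier G. F (inv x \<otimes> g \<otimes> x) / of_nat (card K)) / of_nat (card H)"
    unfolding induced_character_eq[OF fin] indH sum_eq ..
  also have "\<dots> = (\<Sum>x\<in>carrier G. F (inv x \<otimes> g \<otimes> x)) / of_nat (card K)"
    using finH subgroup.one_closed[OF H] by (auto simp: sum_divide_distrib card_eq_0_iff)
  also have "\<dots> = induced_character G K \<psi> g"
    unfolding induced_character_eq[OF fin] F_def ..
  finally show ?thesis .
qed

text \<open>Elements outside \<open>H\<close> move the range of the joint eigenprojection
  \<open>p\<close> to other eigenvalues, so \<open>p * \<sigma> x * p = 0\<close> for them. If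
  \<open>M\<close> commutes with \<open>H\<close> on the range of \<open>p\<close>, the sum of its
  conjugates over \<open>G\<close> is scalar by Schur, while the corner of this sum at
  \<open>p\<close> is \<open>card H\<close> times \<open>M\<close>; hence \<open>M\<close> is
  scalar. The case \<open>M = p\<close> yields the character formula.\<close>

lemma (in group) irreducible_fmat_rep_induced:
  fixes \<sigma> :: "'a \<Rightarrow> fmat"
  assumes fin: "finite (carrier G)"
    and irr: "irreducible_fmat_rep G \<sigma>"
    and N: "N \<subseteq> carrier G"
    and comm: "\<And>x y. x \<in> N \<Longrightarrow> y \<in> N \<Longrightarrow> \<sigma> x * \<sigma> y = \<sigma> y * \<sigma> x"
    and H: "subgroup H G"
    and HN: "\<And>h n. h \<in> H \<Longrightarrow> n \<in> N \<Longrightarrow> \<sigma> h * \<sigma> n = \<sigma> n * \<sigma> h"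
    and out: "\<And>x. x \<in> carrier G \<Longrightarrow> x \<notin> H \<Longrightarrow>
      \<exists>n\<in>N. \<exists>c. c \<noteq> 1 \<and> \<sigma> x * \<sigma> n = c \<cdot>\<^sub>f (\<sigma> n * \<sigma> x)"
  shows "\<exists>\<tau>. irreducible_fmat_rep (G\<lparr>carrier := H\<rparr>) \<tau> \<and>
    (\<forall>g\<in>carrier G. ftrace (\<sigma> g) = induced_character G H (\<lambda>h. ftrace (\<tau> h)) g)"
proof -
  have hom: "\<And>x y. x \<in> carrier G \<Longrightarrow> y \<in> carrier G \<Longrightarrow> \<sigma> (x \<otimes> y) = \<sigma> x * \<sigma> y"
    and nz: "\<sigma> \<one> \<noteq> 0"
    and schur: "\<And>M. \<sigma> \<one> * M * \<sigma> \<one> = M \<Longrightarrow> (\<And>g. g \<in> carrier G \<Longrightarrow> M * \<sigma> g = \<sigma> g * M) \<Longrightarrow>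
      \<exists>c. M = c \<cdot>\<^sub>f \<sigma> \<one>"
    using irr unfolding irreducible_fmat_rep_def by blast+
  have HG: "H \<subseteq> carrier G" using H by (rule subgroup.subset)
  then have finH: "finite H" using fin finite_subset by blast
  have cardH: "card H > 0" using finH subgroup.one_closed[OF H] by (auto simp: card_gt_0_iff)
  have one: "\<sigma> \<one> * \<sigma> x = \<sigma> x" "\<sigma> x * \<sigma> \<one> = \<sigma> x" if "x \<in> carrier G" for x
    using that hom[of \<one> x] hom[of x \<one>] by auto
  have inv: "\<sigma> x * \<sigma> (inv x) = \<sigma> \<one>" "\<sigma> (inv x) * \<sigma> x = \<sigma> \<one>" if "x \<in> carrier G" for x
    using that hom[of x "inv x"] hom[of "inv x" x] by auto
  obtain p c where p: "p \<noteq> 0" "p * p = p" "\<sigma> \<one> * p = p" "\<And>n. n \<in> N \<Longrightarrow> \<sigma> n * p = c n \<cdot>\<^sub>f p"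
    and dc: "\<And>M. M * \<sigma> \<one> = \<sigma> \<one> * M \<Longrightarrow> (\<And>n. n \<in> N \<Longrightarrow> M * \<sigma> n = \<sigma> n * M) \<Longrightarrow> M * p = p * M"
    using common_eigenprojection[OF fin hom nz N comm] by blast
  have p1: "p * \<sigma> \<one> = p"
  proof -
    have "\<sigma> \<one> * p = p * \<sigma> \<one>" using N by (intro dc) (auto simp: one)
    then show ?thesis using p(3) by simp
  qed
  have pH: "\<sigma> h * p = p * \<sigma> h" if "h \<in> H" for h
    using that HG by (intro dc) (auto simp: HN one)
  have pN: "p * \<sigma> n = \<sigma> n * p" if "n \<in> N" for n
    by (rule dc[symmetric]) (use that N in \<open>auto simp: comm one\<close>)
  \<comment> \<open>On the range of \<open>\<sigma> x * p\<close> the matrix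
    \<open>\<sigma> n\<close> has an eigenvalue different from \<open>c n\<close>, because
    \<open>d \<noteq> 1\<close>. Comparing the two ways of moving \<open>\<sigma> n\<close> to a
    factor \<open>p\<close> makes the corner vanish.\<close>
  have p_out: "p * \<sigma> x * p = 0" if x: "x \<in> carrier G" "x \<notin> H" for x
  proof -
    obtain n d where n: "n \<in> N" and d: "d \<noteq> 1" "\<sigma> x * \<sigma> n = d \<cdot>\<^sub>f (\<sigma> n * \<sigma> x)"
      using out[OF x] by blast
    have "c n \<cdot>\<^sub>f (p * \<sigma> x * p) = p * \<sigma> x * (\<sigma> n * p)"
      using p(4)[OF n] by simp
    also have "\<dots> = p * (\<sigma> x * \<sigma> n) * p"
      by (simp add: mult.assoc)
    also have "\<dots> = d \<cdot>\<^sub>f ((p * \<sigma> n) * \<sigma> x * p)"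
      by (simp add: d mult.assoc)
    also have "\<dots> = (d * c n) \<cdot>\<^sub>f (p * \<sigma> x * p)"
      by (simp add: pN[OF n] p(4)[OF n])
    finally have "c n = d * c n" if "p * \<sigma> x * p \<noteq> 0"
      using that fscale_cancel by metis
    moreover have "c n \<noteq> 0"
    proof
      assume "c n = 0"
      then have "\<sigma> (inv n) * (\<sigma> n * p) = 0" using p(4)[OF n] by simp
      moreover have "\<sigma> (inv n) * (\<sigma> n * p) = p"
        using inv[of n] n N p(3) by (auto simp: mult.assoc[symmetric])
      ultimately show False using p(1) by simp
    qed
    ultimately show ?thesis using d by auto
  qed
  define avg where "avg M = (\<Sum>x\<in>carrier G. \<sigma> x * M * \<sigma> (inv x))" for M
  have avg_scalar: "\<exists>d. avg M = d \<cdot>\<^sub>f \<sigma> \<one>" for M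
  proof (rule schur)
    show "\<sigma> \<one> * avg M * \<sigma> \<one> = avg M"
      by (simp add: avg_def sum_distrib_left sum_distrib_right mult.assoc one)
        (simp add: one mult.assoc[symmetric])
    fix g assume g: "g \<in> carrier G"
    have "\<sigma> g * avg M = (\<Sum>x\<in>carrier G. \<sigma> (g \<otimes> x) * M * \<sigma> (inv (g \<otimes> x)) * \<sigma> g)"
      using g by (auto simp: avg_def sum_distrib_left hom inv_mult_group mult.assoc inv one intro!: sum.cong)
    also have "\<dots> = (\<Sum>x\<in>carrier G. \<sigma> x * M * \<sigma> (inv x) * \<sigma> g)"
    proof (rule sum.reindex_bij_betw)
      show "bij_betw (\<lambda>x. g \<otimes> x) (carrier G) (carrier G)"
        by (rule bij_betwI[where g = "\<lambda>x. inv g \<otimes> x"]) (use g in \<open>auto simp: m_assoc[symmetric]\<close>)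
    qed
    finally show "avg M * \<sigma> g = \<sigma> g * avg M"
      by (simp add: avg_def sum_distrib_right)
  qed
  \<comment> \<open>Since \<open>M = p * M\<close>, each summand contains the corner
    \<open>p * \<sigma> x * p\<close>. Only \<open>x\<close> in \<open>H\<close> survive, and there
    \<open>\<sigma> x\<close> passes through \<open>M\<close> and cancels against its
    inverse.\<close>
  have p_avg: "p * avg M * p = of_nat (card H) \<cdot>\<^sub>f M"
    if M: "p * M = M" "M * p = M" "\<And>h. h \<in> H \<Longrightarrow> M * \<sigma> h = \<sigma> h * M" for M
  proof -
    have "p * avg M * p = (\<Sum>x\<in>carrier G. (p * \<sigma> x * p) * M * (\<sigma> (inv x) * p))"
    proof -
      have "p * (\<sigma> x * M * \<sigma> (inv x)) * p = (p * \<sigma> x * p) * M * (\<sigma> (inv x) * p)" for x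
        using M(1) by (metis mult.assoc)
      then show ?thesis by (simp add: avg_def sum_distrib_left sum_distrib_right)
    qed
    also have "\<dots> = (\<Sum>x\<in>carrier G. if x \<in> H then M else 0)"
    proof (rule sum.cong[OF refl])
      fix x assume x: "x \<in> carrier G"
      show "(p * \<sigma> x * p) * M * (\<sigma> (inv x) * p) = (if x \<in> H then M else 0)"
      proof (cases "x \<in> H")
        case True
        have "(p * \<sigma> x * p) * M * (\<sigma> (inv x) * p) = p * (\<sigma> x * M) * \<sigma> (inv x) * p"
          using M(1) by (metis mult.assoc)
        also have "\<dots> = p * M * (\<sigma> x * \<sigma> (inv x)) * p"
          by (simp add: M(3)[OF True, symmetric] mult.assoc)
        also have "\<dots> = M"
          using M p inv[OF x] by (simp add: mult.assoc)
        finally show ?thesis using True by simp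
      next
        case False
        then show ?thesis using p_out[OF x] by simp
      qed
    qed
    also have "\<dots> = (\<Sum>x\<in>H. M)"
      using fin HG by (simp add: sum.If_cases Int_absorb1)
    also have "\<dots> = of_nat (card H) \<cdot>\<^sub>f M"
      using fscale_sum_left[of "\<lambda>_. 1" H M] by simp
    finally show ?thesis .
  qed
  \<comment> \<open>The action of \<open>H\<close> on the range of \<open>p\<close>; the unit of the
    new representation is \<open>p\<close> itself.\<close>
  define \<tau> where "\<tau> h = \<sigma> h * p" for h
  have "irreducible_fmat_rep (G\<lparr>carrier := H\<rparr>) \<tau>"
    unfolding irreducible_fmat_rep_def
  proof (simp, intro conjI ballI allI impI)
    fix x y assume xy: "x \<in> H" "y \<in> H"
    have "\<sigma> (x \<otimes> y) * p = \<sigma> x * (\<sigma> y * p) * p"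
      using xy HG p(2) by (simp add: hom subset_iff mult.assoc)
    then show "\<tau> (x \<otimes> y) = \<tau> x * \<tau> y"
      using pH[OF xy(2)] by (simp add: \<tau>_def mult.assoc)
  next
    show "\<tau> \<one> \<noteq> 0" using p by (simp add: \<tau>_def)
  next
    fix M assume M: "\<tau> \<one> * M * \<tau> \<one> = M" and Mc: "\<forall>g\<in>H. M * \<tau> g = \<tau> g * M"
    have t1: "\<tau> \<one> = p" using p by (simp add: \<tau>_def)
    have "p * (p * M * p) = p * M * p" "p * M * p * p = p * M * p"
      using p(2) by (simp_all add: mult.assoc[symmetric]) (simp add: mult.assoc)
    then have pM: "p * M = M" "M * p = M"
      using M unfolding t1 by simp_all
    have "M * \<sigma> h = \<sigma> h * M" if h: "h \<in> H" for h
    proof -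
      have "M * \<sigma> h = M * (\<sigma> h * p)"
        by (simp add: pH[OF h] mult.assoc[symmetric] pM)
      also have "\<dots> = \<sigma> h * (p * M)"
        using Mc h by (simp add: \<tau>_def mult.assoc)
      finally show ?thesis using pM by simp
    qed
    then have "p * avg M * p = of_nat (card H) \<cdot>\<^sub>f M"
      by (rule p_avg[OF pM])
    moreover obtain d where "avg M = d \<cdot>\<^sub>f \<sigma> \<one>" using avg_scalar by blast
    ultimately have "of_nat (card H) \<cdot>\<^sub>f M = d \<cdot>\<^sub>f p"
      using p p1 by simp
    then have "(1 / of_nat (card H)) \<cdot>\<^sub>f of_nat (card H) \<cdot>\<^sub>f M = (1 / of_nat (card H)) \<cdot>\<^sub>f d \<cdot>\<^sub>f p"
      by simp
    then have "M = (1 / of_nat (card H) * d) \<cdot>\<^sub>f p"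
      using cardH by (simp del: fscale_times)
    then show "\<exists>c. M = c \<cdot>\<^sub>f \<tau> \<one>" unfolding t1 by blast
  qed
  moreover have "ftrace (\<sigma> g) = induced_character G H (\<lambda>h. ftrace (\<tau> h)) g" if g: "g \<in> carrier G" for g
  proof -
    \<comment> \<open>Comparing corners determines the scalar as \<open>card H\<close>. So
      \<open>card H\<close> times \<open>\<sigma> \<one>\<close> is the sum of all conjugates of
      \<open>p\<close>, and multiplying by \<open>\<sigma> g\<close> and taking traces gives the
      induction formula.\<close>
    obtain d where d: "avg p = d \<cdot>\<^sub>f \<sigma> \<one>" using avg_scalar by blast
    have "p * avg p * p = of_nat (card H) \<cdot>\<^sub>f p"
      by (rule p_avg) (use p pH in auto)
    then have "d \<cdot>\<^sub>f p = of_nat (card H) \<cdot>\<^sub>f p"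
      using d p p1 by simp
    then have "d = of_nat (card H)" using p fscale_cancel by blast
    then have "of_nat (card H) * ftrace (\<sigma> g) = ftrace (\<sigma> g * avg p)"
      using d g by (simp add: one ftrace_scale)
    also have "\<dots> = (\<Sum>x\<in>carrier G. ftrace (\<sigma> g * (\<sigma> x * p * \<sigma> (inv x))))"
      by (simp add: avg_def sum_distrib_left ftrace_sum)
    also have "\<dots> = (\<Sum>x\<in>carrier G. if inv x \<otimes> g \<otimes> x \<in> H then ftrace (\<tau> (inv x \<otimes> g \<otimes> x)) else 0)"
    proof (rule sum.cong[OF refl])
      fix x assume x: "x \<in> carrier G"
      have "ftrace (\<sigma> g * (\<sigma> x * p * \<sigma> (inv x))) = ftrace ((\<sigma> g * \<sigma> x * p) * \<sigma> (inv x))"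
        by (simp add: mult.assoc)
      also have "\<dots> = ftrace (\<sigma> (inv x \<otimes> g \<otimes> x) * p)"
        using x g by (subst ftrace_commute) (simp add: hom mult.assoc)
      finally have e: "ftrace (\<sigma> g * (\<sigma> x * p * \<sigma> (inv x))) = ftrace (\<sigma> (inv x \<otimes> g \<otimes> x) * p)" .
      \<comment> \<open>As \<open>p\<close> is idempotent and the trace is cyclic, \<open>p\<close>
        may be put on both sides, where \<open>p_out\<close> applies.\<close>
      have "ftrace (\<sigma> (inv x \<otimes> g \<otimes> x) * p) = 0" if "inv x \<otimes> g \<otimes> x \<notin> H"
      proof -
        have "ftrace (\<sigma> (inv x \<otimes> g \<otimes> x) * p) = ftrace (\<sigma> (inv x \<otimes> g \<otimes> x) * p * p)"
          using p(2) by (simp add: mult.assoc)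
        also have "\<dots> = ftrace (p * \<sigma> (inv x \<otimes> g \<otimes> x) * p)"
          by (subst ftrace_commute) (simp add: mult.assoc)
        finally show ?thesis using p_out[OF _ that] x g by simp
      qed
      then show "ftrace (\<sigma> g * (\<sigma> x * p * \<sigma> (inv x)))
          = (if inv x \<otimes> g \<otimes> x \<in> H then ftrace (\<tau> (inv x \<otimes> g \<otimes> x)) else 0)"
        by (simp add: e \<tau>_def)
    qed
    finally show ?thesis
      using cardH by (simp add: induced_character_eq[OF fin] field_simps)
  qed
  ultimately show ?thesis by blast
qed

section \<open>Nilpotent subrings and their unit groups\<close>

text \<open>Index \<open>k\<close> stands for \<open>k + 1\<close> factors, so index
  \<open>0\<close> is \<open>U\<close> itself. The set contains the products alone, not their
  sums.\<close>

primrec products :: "('a, 'b) ring_scheme \<Rightarrow> 'a set \<Rightarrow> nat \<Rightarrow> 'a set" where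
  "products R U 0 = U"
| "products R U (Suc k) = {x \<otimes>\<^bsub>R\<^esub> u | x u. x \<in> products R U k \<and> u \<in> U}"

lemma products_mono: "V \<subseteq> U \<Longrightarrow> products R V k \<subseteq> products R U k"
  by (induction k) auto

definition nilpotent_subring :: "('a, 'b) ring_scheme \<Rightarrow> 'a set \<Rightarrow> bool" where
  "nilpotent_subring R U \<longleftrightarrow> U \<subseteq> carrier R \<and> \<zero>\<^bsub>R\<^esub> \<in> U \<and>
    (\<forall>u\<in>U. \<forall>v\<in>U. u \<oplus>\<^bsub>R\<^esub> v \<in> U \<and> u \<otimes>\<^bsub>R\<^esub> v \<in> U) \<and> (\<forall>u\<in>U. \<ominus>\<^bsub>R\<^esub> u \<in> U) \<and>
    (\<exists>k. products R U k \<subseteq> {\<zero>\<^bsub>R\<^esub>})"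

lemma nilpotent_subringD:
  assumes "nilpotent_subring R U"
  shows "U \<subseteq> carrier R" "\<zero>\<^bsub>R\<^esub> \<in> U" "u \<in> U \<Longrightarrow> v \<in> U \<Longrightarrow> u \<oplus>\<^bsub>R\<^esub> v \<in> U"
    "u \<in> U \<Longrightarrow> v \<in> U \<Longrightarrow> u \<otimes>\<^bsub>R\<^esub> v \<in> U" "u \<in> U \<Longrightarrow> \<ominus>\<^bsub>R\<^esub> u \<in> U"
    "\<exists>k. products R U k \<subseteq> {\<zero>\<^bsub>R\<^esub>}"
  using assms by (auto simp: nilpotent_subring_def)

lemma nilpotent_subring_subset:
  assumes "nilpotent_subring R U" "V \<subseteq> U" "\<zero>\<^bsub>R\<^esub> \<in> V"
    "\<And>u v. u \<in> V \<Longrightarrow> v \<in> V \<Longrightarrow> u \<oplus>\<^bsub>R\<^esub> v \<in> V \<and> u \<otimes>\<^bsub>R\<^esub> v \<in> V" "\<And>u. u \<in> V \<Longrightarrow> \<ominus>\<^bsub>R\<^esub> u \<in> V"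
  shows "nilpotent_subring R V"
proof -
  obtain k where "products R U k \<subseteq> {\<zero>\<^bsub>R\<^esub>}" using nilpotent_subringD(6)[OF assms(1)] by blast
  then have "products R V k \<subseteq> {\<zero>\<^bsub>R\<^esub>}" using products_mono[OF assms(2)] by fast
  then show ?thesis
    using assms nilpotent_subringD(1)[OF assms(1)] unfolding nilpotent_subring_def by blast
qed

text \<open>The record has the shape of \<open>algebra_group\<close>, with any \<open>U\<close> in
  place of the radical. Restricting the carrier to \<open>one_plus R V\<close> gives literally
  \<open>unit_group R V\<close>, to which the induction hypothesis applies.\<close>

definition unit_group :: "('a, 'b) ring_scheme \<Rightarrow> 'a set \<Rightarrow> 'a monoid" where
  "unit_group R U = \<lparr>carrier = one_plus R U, monoid.mult = (\<otimes>\<^bsub>R\<^esub>), one = \<one>\<^bsub>R\<^esub>\<rparr>"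

lemma unit_group_simps [simp]:
  "carrier (unit_group R U) = one_plus R U" "x \<otimes>\<^bsub>unit_group R U\<^esub> y = x \<otimes>\<^bsub>R\<^esub> y"
  "\<one>\<^bsub>unit_group R U\<^esub> = \<one>\<^bsub>R\<^esub>" "unit_group R U\<lparr>carrier := one_plus R V\<rparr> = unit_group R V"
  by (simp_all add: unit_group_def)

lemma one_plus_I: "u \<in> U \<Longrightarrow> \<one>\<^bsub>R\<^esub> \<oplus>\<^bsub>R\<^esub> u \<in> one_plus R U"
  by (auto simp: one_plus_def)

lemma one_plus_E:
  assumes "x \<in> one_plus R U"
  obtains u where "u \<in> U" "x = \<one>\<^bsub>R\<^esub> \<oplus>\<^bsub>R\<^esub> u"
  using assms by (auto simp: one_plus_def)

lemma one_plus_mono: "V \<subseteq> U \<Longrightarrow> one_plus R V \<subseteq> one_plus R U"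
  by (auto simp: one_plus_def)

lemma finite_one_plus: "finite U \<Longrightarrow> finite (one_plus R U)"
proof -
  have "one_plus R U = (\<lambda>u. \<one>\<^bsub>R\<^esub> \<oplus>\<^bsub>R\<^esub> u) ` U" by (auto simp: one_plus_def)
  then show "finite U \<Longrightarrow> finite (one_plus R U)" by simp
qed

context ring
begin

lemma one_plus_mult:
  "u \<in> carrier R \<Longrightarrow> v \<in> carrier R \<Longrightarrow> (\<one> \<oplus> u) \<otimes> (\<one> \<oplus> v) = \<one> \<oplus> (u \<oplus> v \<oplus> u \<otimes> v)"
  by (simp add: l_distr r_distr a_ac)

lemma products_closed:
  assumes "nilpotent_subring R U"
  shows "products R U k \<subseteq> U"
  by (induction k) (use nilpotent_subringD[OF assms] in auto)

text \<open>Products grow on the right by definition; reassociating lets a new factor on the left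
  count as well.\<close>

lemma products_mult_left:
  assumes "nilpotent_subring R U" "u \<in> U" "x \<in> products R U k"
  shows "u \<otimes> x \<in> products R U (Suc k)"
  using assms(3)
proof (induction k arbitrary: x)
  case 0
  then show ?case using assms(2) by auto
next
  case (Suc k)
  then obtain y v where yv: "x = y \<otimes> v" "y \<in> products R U k" "v \<in> U" by auto
  then have "u \<otimes> x = (u \<otimes> y) \<otimes> v"
    using assms(2) products_closed[OF assms(1)] nilpotent_subringD(1)[OF assms(1)]
    by (subst m_assoc) auto
  moreover have "u \<otimes> y \<in> products R U (Suc k)" using Suc.IH yv by blast
  ultimately show ?case using yv(3) by (subst products.simps) blast
qed

text \<open>Finiteness replaces the geometric series. The additive map sending \<open>v\<close> to
  \<open>v \<oplus> u \<otimes> v\<close> is injective, since an element \<open>d\<close> of its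
  kernel satisfies \<open>d = \<ominus> u \<otimes> d\<close> and so lies in arbitrarily long
  products. Hence the map is onto, and a preimage of \<open>\<ominus> u\<close> is the required
  \<open>v\<close>.\<close>

lemma nilpotent_subring_right_inverse:
  assumes U: "nilpotent_subring R U" and "finite U" and u: "u \<in> U"
  shows "\<exists>v\<in>U. (\<one> \<oplus> u) \<otimes> (\<one> \<oplus> v) = \<one>"
proof -
  note D = nilpotent_subringD[OF U]
  have c: "v \<in> U \<Longrightarrow> v \<in> carrier R" for v using D(1) by blast
  have "inj_on (\<lambda>v. v \<oplus> u \<otimes> v) U"
  proof (rule inj_onI)
    fix v w assume vw: "v \<in> U" "w \<in> U" and e: "v \<oplus> u \<otimes> v = w \<oplus> u \<otimes> w"
    define d where "d = v \<ominus> w"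
    have dU: "d \<in> U" using vw D by (simp add: d_def a_minus_def)
    have d: "d = \<ominus> u \<otimes> d"
    proof -
      have "d \<oplus> u \<otimes> d = (v \<oplus> u \<otimes> v) \<ominus> (w \<oplus> u \<otimes> w)"
        using vw u c by (simp add: d_def a_minus_def r_distr r_minus minus_add a_ac)
      also have "\<dots> = \<zero>" using e vw u c by (simp add: a_minus_def r_neg)
      finally have "d = \<ominus> (u \<otimes> d)"
        using dU u c by (intro minus_equality[symmetric]) auto
      then show ?thesis using dU u c by (simp add: l_minus)
    qed
    have mu: "\<ominus> u \<in> U" using D u by simp
    have "d \<in> products R U k" for k
    proof (induction k)
      case (Suc k)
      then have "\<ominus> u \<otimes> d \<in> products R U (Suc k)" by (rule products_mult_left[OF U mu])
      then show ?case unfolding d[symmetric] .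
    qed (simp add: dU)
    then have "d = \<zero>" using D(6) by auto
    then show "v = w" using vw c by (simp add: d_def)
  qed
  moreover have "(\<lambda>v. v \<oplus> u \<otimes> v) ` U \<subseteq> U" using u D by auto
  ultimately have "(\<lambda>v. v \<oplus> u \<otimes> v) ` U = U"
    using \<open>finite U\<close> endo_inj_surj by blast
  then have "\<ominus> u \<in> (\<lambda>v. v \<oplus> u \<otimes> v) ` U"
    using D(5)[OF u] by (simp only:)
  then obtain v where v: "v \<in> U" "v \<oplus> u \<otimes> v = \<ominus> u"
    by (elim imageE) (rule that, simp_all only:)
  have "(\<one> \<oplus> u) \<otimes> (\<one> \<oplus> v) = \<one> \<oplus> (u \<oplus> (v \<oplus> u \<otimes> v))"
    using u v c by (simp add: one_plus_mult a_assoc)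
  then show ?thesis using u c v by (auto simp: r_neg)
qed

text \<open>The right inverse \<open>\<one> \<oplus> v\<close> has a right inverse of its own, and
  associativity identifies that one with \<open>\<one> \<oplus> u\<close>.\<close>

lemma nilpotent_subring_inverse:
  assumes U: "nilpotent_subring R U" and "finite U" and u: "u \<in> U"
  obtains v where "v \<in> U" "(\<one> \<oplus> u) \<otimes> (\<one> \<oplus> v) = \<one>" "(\<one> \<oplus> v) \<otimes> (\<one> \<oplus> u) = \<one>"
proof -
  have c: "v \<in> U \<Longrightarrow> v \<in> carrier R" for v using nilpotent_subringD(1)[OF U] by blast
  obtain v where v: "v \<in> U" "(\<one> \<oplus> u) \<otimes> (\<one> \<oplus> v) = \<one>"
    using nilpotent_subring_right_inverse[OF assms] by blast
  obtain w where w: "w \<in> U" "(\<one> \<oplus> v) \<otimes> (\<one> \<oplus> w) = \<one>"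
    using nilpotent_subring_right_inverse[OF U \<open>finite U\<close> v(1)] by blast
  have "\<one> \<oplus> u = (\<one> \<oplus> u) \<otimes> ((\<one> \<oplus> v) \<otimes> (\<one> \<oplus> w))"
    using w u c by simp
  also have "\<dots> = \<one> \<oplus> w"
    using u v w c by (subst m_assoc[symmetric]) auto
  finally show thesis using that v w by auto
qed

lemma group_unit_group:
  assumes U: "nilpotent_subring R U" and "finite U"
  shows "group (unit_group R U)"
proof (rule groupI, goal_cases)
  note D = nilpotent_subringD[OF U]
  have c: "v \<in> U \<Longrightarrow> v \<in> carrier R" for v using D(1) by blast
  {
    case (1 x y)
    then show ?case using D c by (auto simp: one_plus_mult elim!: one_plus_E intro!: one_plus_I)
  next
    case 2
    then show ?case using one_plus_I[OF D(2), of R] by simp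
  next
    case (3 x y z)
    then show ?case using c by (auto simp: m_assoc elim!: one_plus_E)
  next
    case (4 x)
    then show ?case using c by (auto elim!: one_plus_E)
  next
    case (5 x)
    then obtain u where u: "u \<in> U" "x = \<one> \<oplus> u" by (auto elim: one_plus_E)
    obtain v where "v \<in> U" "(\<one> \<oplus> v) \<otimes> (\<one> \<oplus> u) = \<one>"
      using nilpotent_subring_inverse[OF U \<open>finite U\<close> u(1)] .
    then show ?case using u by (auto intro!: bexI[of _ "\<one> \<oplus> v"] one_plus_I)
  }
qed

lemma subgroup_unit_group:
  assumes U: "nilpotent_subring R U" and V: "nilpotent_subring R V" and "V \<subseteq> U" "finite U"
  shows "subgroup (one_plus R V) (unit_group R U)"
proof -
  interpret G: group "unit_group R U" using U \<open>finite U\<close> by (rule group_unit_group)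
  have finV: "finite V" using \<open>V \<subseteq> U\<close> \<open>finite U\<close> finite_subset by blast
  interpret H: group "unit_group R V" using V finV by (rule group_unit_group)
  show ?thesis
  proof (rule G.subgroupI)
    show "one_plus R V \<subseteq> carrier (unit_group R U)" using one_plus_mono[OF \<open>V \<subseteq> U\<close>] by simp
    show "one_plus R V \<noteq> {}" using H.one_closed by auto
    fix a assume a: "a \<in> one_plus R V"
    then have i: "inv\<^bsub>unit_group R V\<^esub> a \<in> one_plus R V" using H.inv_closed by simp
    have "inv\<^bsub>unit_group R U\<^esub> a = inv\<^bsub>unit_group R V\<^esub> a"
      using a i one_plus_mono[OF \<open>V \<subseteq> U\<close>] H.l_inv[of a] by (intro G.inv_equality) auto
    then show "inv\<^bsub>unit_group R U\<^esub> a \<in> one_plus R V" using i by simp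
  next
    fix a b assume "a \<in> one_plus R V" "b \<in> one_plus R V"
    then show "a \<otimes>\<^bsub>unit_group R U\<^esub> b \<in> one_plus R V" using H.m_closed by simp
  qed
qed

end

section \<open>The commutator pairing\<close>

text \<open>The scalar is indexed by \<open>c\<close> rather than by
  \<open>\<one> \<oplus> c\<close>, so that ring expressions can be its argument; the homomorphism
  property then reads \<open>\<psi> (c \<oplus> d \<oplus> c \<otimes> d) = \<psi> c * \<psi>
  d\<close>. The setting is purely ring theoretic: the field enters only later, through the
  multiples of one element \<open>y\<close>.\<close>

locale scalar_ideal = ring +
  fixes U C :: "'a set" and \<sigma> :: "'a \<Rightarrow> fmat" and \<psi> :: "'a \<Rightarrow> complex"
  assumes U: "nilpotent_subring R U" and finU: "finite U"
    and C_U [simp]: "c \<in> C \<Longrightarrow> c \<in> U"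
    and C_zero [simp]: "\<zero> \<in> C"
    and C_add [simp]: "c \<in> C \<Longrightarrow> d \<in> C \<Longrightarrow> c \<oplus> d \<in> C"
    and C_minus [simp]: "c \<in> C \<Longrightarrow> \<ominus> c \<in> C"
    and C_left [simp]: "c \<in> C \<Longrightarrow> u \<in> U \<Longrightarrow> u \<otimes> c \<in> C"
    and C_right [simp]: "c \<in> C \<Longrightarrow> u \<in> U \<Longrightarrow> c \<otimes> u \<in> C"
    and \<sigma>_mult: "x \<in> one_plus R U \<Longrightarrow> y \<in> one_plus R U \<Longrightarrow> \<sigma> (x \<otimes> y) = \<sigma> x * \<sigma> y"
    and \<sigma>_one: "\<sigma> \<one> \<noteq> 0"
    and \<sigma>_C: "c \<in> C \<Longrightarrow> \<sigma> (\<one> \<oplus> c) = \<psi> c \<cdot>\<^sub>f \<sigma> \<one>"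
begin

lemma U_carrier [simp]: "u \<in> U \<Longrightarrow> u \<in> carrier R"
  and U_zero [simp]: "\<zero> \<in> U"
  and U_add [simp]: "u \<in> U \<Longrightarrow> v \<in> U \<Longrightarrow> u \<oplus> v \<in> U"
  and U_mult [simp]: "u \<in> U \<Longrightarrow> v \<in> U \<Longrightarrow> u \<otimes> v \<in> U"
  and U_minus [simp]: "u \<in> U \<Longrightarrow> \<ominus> u \<in> U"
  using nilpotent_subringD[OF U] by blast+

lemma nilpotent_C: "nilpotent_subring R C"
  by (rule nilpotent_subring_subset[OF U]) auto

lemma finite_C: "finite C"
  using finU C_U by (meson finite_subset subsetI)

lemma one_in: "\<one> \<in> one_plus R U"
  using one_plus_I[OF U_zero, of R] by simp

lemma \<sigma>_mult_one [simp]: "x \<in> one_plus R U \<Longrightarrow> \<sigma> \<one> * \<sigma> x = \<sigma> x"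
    "x \<in> one_plus R U \<Longrightarrow> \<sigma> x * \<sigma> \<one> = \<sigma> x"
proof -
  assume x: "x \<in> one_plus R U"
  then have "x \<in> carrier R" by (auto elim: one_plus_E)
  then show "\<sigma> \<one> * \<sigma> x = \<sigma> x" "\<sigma> x * \<sigma> \<one> = \<sigma> x"
    using \<sigma>_mult[OF one_in x] \<sigma>_mult[OF x one_in] by simp_all
qed

lemma \<sigma>_nonzero: "u \<in> U \<Longrightarrow> \<sigma> (\<one> \<oplus> u) \<noteq> 0"
proof
  assume u: "u \<in> U" and z: "\<sigma> (\<one> \<oplus> u) = 0"
  obtain v where v: "v \<in> U" "(\<one> \<oplus> u) \<otimes> (\<one> \<oplus> v) = \<one>"
    using nilpotent_subring_inverse[OF U finU u] .
  then show False
    using \<sigma>_mult[of "\<one> \<oplus> u" "\<one> \<oplus> v"] u z \<sigma>_one by (simp add: one_plus_I)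
qed

lemma \<psi>_nonzero: "c \<in> C \<Longrightarrow> \<psi> c \<noteq> 0"
  using \<sigma>_nonzero[of c] \<sigma>_C[of c] by auto

lemma \<sigma>_C_mult:
  assumes "c \<in> C" "u \<in> U"
  shows "\<sigma> ((\<one> \<oplus> c) \<otimes> (\<one> \<oplus> u)) = \<psi> c \<cdot>\<^sub>f \<sigma> (\<one> \<oplus> u)"
    "\<sigma> ((\<one> \<oplus> u) \<otimes> (\<one> \<oplus> c)) = \<psi> c \<cdot>\<^sub>f \<sigma> (\<one> \<oplus> u)"
  using assms by (simp_all add: \<sigma>_mult one_plus_I \<sigma>_C)

lemma \<psi>_mult:
  assumes "c \<in> C" "d \<in> C"
  shows "\<psi> (c \<oplus> d \<oplus> c \<otimes> d) = \<psi> c * \<psi> d"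
proof -
  have "\<psi> (c \<oplus> d \<oplus> c \<otimes> d) \<cdot>\<^sub>f \<sigma> \<one> = (\<psi> c * \<psi> d) \<cdot>\<^sub>f \<sigma> \<one>"
    using assms \<sigma>_C_mult(1)[of c d] by (simp add: one_plus_mult \<sigma>_C[symmetric])
      (simp add: \<sigma>_C)
  then show ?thesis using \<sigma>_one fscale_cancel by blast
qed

lemma \<psi>_conj:
  assumes "c \<in> C" "d \<in> C" "v \<in> U" "(\<one> \<oplus> v) \<otimes> (\<one> \<oplus> c) = (\<one> \<oplus> d) \<otimes> (\<one> \<oplus> v)"
  shows "\<psi> c = \<psi> d"
  using assms \<sigma>_C_mult[of c v] \<sigma>_C_mult[of d v] \<sigma>_nonzero[of v] fscale_cancel by metis

text \<open>Conjugation by \<open>\<one> \<oplus> v\<close> takes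
  \<open>c \<otimes> (\<one> \<oplus> v)\<close> to
  \<open>(\<one> \<oplus> v) \<otimes> c\<close>.\<close>

lemma \<psi>_commute_unit:
  assumes "c \<in> C" "v \<in> U"
  shows "\<psi> (c \<oplus> c \<otimes> v) = \<psi> (c \<oplus> v \<otimes> c)"
  using assms by (intro \<psi>_conj[where v = v]) (simp_all add: l_distr r_distr a_ac m_assoc)

text \<open>The preceding lemma has an extra summand \<open>c\<close>, to be split off
  multiplicatively. The choice of \<open>c = w\<close> with \<open>1 + w\<close> inverse to
  \<open>1 - u\<close> does this: \<open>1 + w + w v = (1 + w)(1 + u v)\<close> and
  \<open>1 + w + v w = (1 + v u)(1 + w)\<close>, so that \<open>\<psi> w\<close> cancels.\<close>

lemma \<psi>_commute:
  assumes u: "u \<in> C" and v: "v \<in> U"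
  shows "\<psi> (u \<otimes> v) = \<psi> (v \<otimes> u)"
proof -
  obtain w where w: "w \<in> C" and wl: "(\<one> \<oplus> w) \<otimes> (\<one> \<oplus> \<ominus> u) = \<one>"
    and wr: "(\<one> \<oplus> \<ominus> u) \<otimes> (\<one> \<oplus> w) = \<one>"
    using nilpotent_subring_inverse[OF nilpotent_C finite_C C_minus[OF u]] by metis
  have eqs: "w = u \<oplus> w \<otimes> u" "w = u \<oplus> u \<otimes> w"
  proof -
    have "\<one> \<oplus> w = (\<one> \<oplus> w) \<otimes> (\<one> \<oplus> \<ominus> u) \<oplus> (\<one> \<oplus> w) \<otimes> u"
      using u w by (simp add: r_distr[symmetric] a_assoc l_neg)
    then have "\<one> \<oplus> w = \<one> \<oplus> (u \<oplus> w \<otimes> u)"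
      using u w wl by (simp add: l_distr)
    then show "w = u \<oplus> w \<otimes> u" using u w by simp
    have "\<one> \<oplus> w = (\<one> \<oplus> \<ominus> u) \<otimes> (\<one> \<oplus> w) \<oplus> u \<otimes> (\<one> \<oplus> w)"
      using u w by (simp add: l_distr[symmetric] a_assoc l_neg)
    then have "\<one> \<oplus> w = \<one> \<oplus> (u \<oplus> u \<otimes> w)"
      using u w wr by (simp add: r_distr)
    then show "w = u \<oplus> u \<otimes> w" using u w by simp
  qed
  have "w \<otimes> v = u \<otimes> v \<oplus> w \<otimes> (u \<otimes> v)"
    using u v w arg_cong[OF eqs(1), of "\<lambda>x. x \<otimes> v"] by (simp add: l_distr m_assoc)
  then have 1: "w \<oplus> w \<otimes> v = w \<oplus> u \<otimes> v \<oplus> w \<otimes> (u \<otimes> v)"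
    using u v w by (simp add: a_assoc)
  have "v \<otimes> w = v \<otimes> u \<oplus> (v \<otimes> u) \<otimes> w"
    using u v w arg_cong[OF eqs(2), of "\<lambda>x. v \<otimes> x"] by (simp add: r_distr m_assoc)
  then have 2: "w \<oplus> v \<otimes> w = v \<otimes> u \<oplus> w \<oplus> (v \<otimes> u) \<otimes> w"
    using u v w by (simp add: a_ac)
  have "\<psi> w * \<psi> (u \<otimes> v) = \<psi> (w \<oplus> w \<otimes> v)"
    using u v w by (simp add: 1 \<psi>_mult)
  also have "\<dots> = \<psi> (w \<oplus> v \<otimes> w)"
    using w v by (rule \<psi>_commute_unit)
  also have "\<dots> = \<psi> (v \<otimes> u) * \<psi> w"
    using u v w by (simp add: 2 \<psi>_mult)
  finally show ?thesis using \<psi>_nonzero[OF w] by simp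
qed

text \<open>The preimage of the two-sided annihilator of \<open>U\<close> in the quotient of
  \<open>U\<close> by \<open>C\<close>. For \<open>b\<close> in it, both products occurring in
  \<open>pairing a b\<close> lie in \<open>C\<close>.\<close>

definition B :: "'a set" where
  "B = {b \<in> U. \<forall>u\<in>U. u \<otimes> b \<in> C \<and> b \<otimes> u \<in> C}"

lemma B_simps [simp]: "b \<in> B \<Longrightarrow> b \<in> U" "b \<in> B \<Longrightarrow> u \<in> U \<Longrightarrow> u \<otimes> b \<in> C"
    "b \<in> B \<Longrightarrow> u \<in> U \<Longrightarrow> b \<otimes> u \<in> C"
  by (auto simp: B_def)

text \<open>\<open>pairing a b\<close> is the scalar by which the commutator of \<open>1 + a\<close> and \<open>1 + b\<close> acts.\<close>

definition pairing :: "'a \<Rightarrow> 'a \<Rightarrow> complex" where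
  "pairing a b = \<psi> (a \<otimes> b) / \<psi> (b \<otimes> a)"

text \<open>This is the group version of the identity \<open>[a\<^sub>1 a\<^sub>2, b] = [a\<^sub>1, a\<^sub>2 b] + [a\<^sub>2, b a\<^sub>1]\<close>.\<close>

lemma pairing_product:
  assumes "a1 \<in> U" "a2 \<in> U" "b \<in> B"
  shows "pairing (a1 \<otimes> a2) b = 1"
proof -
  have "\<psi> (a1 \<otimes> a2 \<otimes> b) = \<psi> (a2 \<otimes> b \<otimes> a1)"
    using assms \<psi>_commute[of "a2 \<otimes> b" a1] by (simp add: m_assoc)
  also have "\<dots> = \<psi> (b \<otimes> (a1 \<otimes> a2))"
    using assms \<psi>_commute[of "b \<otimes> a1" a2] by (simp add: m_assoc)
  finally show ?thesis using assms \<psi>_nonzero by (simp add: pairing_def)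
qed

text \<open>To write \<open>(a1 + a2) b\<close> as a circle product, \<open>a2\<close> is replaced
  by \<open>a3 = a2 (1 + b a1)^{-1}\<close>. Then \<open>(a1 + a2) b\<close> is the circle product
  of \<open>a3 b\<close> and \<open>a1 b\<close>, and \<open>b (a1 + a2)\<close> that of
  \<open>b a3\<close> and \<open>b a1\<close>; the same \<open>a3\<close> serves both sides. The
  error \<open>a2 w\<close> is a product, which the pairing does not see.\<close>

lemma pairing_add_twisted:
  assumes a: "a1 \<in> U" "a2 \<in> U" and b: "b \<in> B"
  shows "\<exists>w\<in>C. pairing (a1 \<oplus> a2) b = pairing a1 b * pairing (a2 \<oplus> a2 \<otimes> w) b"
proof -
  have ba: "b \<otimes> a1 \<in> C" using a b by simp
  obtain w where w: "w \<in> C" and wl: "(\<one> \<oplus> w) \<otimes> (\<one> \<oplus> b \<otimes> a1) = \<one>"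
    using nilpotent_subring_inverse[OF nilpotent_C finite_C ba] by metis
  define a3 where "a3 = a2 \<oplus> a2 \<otimes> w"
  have a3: "a3 \<in> U" using a w by (simp add: a3_def)
  have a3': "a3 \<otimes> (\<one> \<oplus> b \<otimes> a1) = a2"
  proof -
    have "a3 = a2 \<otimes> (\<one> \<oplus> w)" using a w by (simp add: a3_def r_distr)
    then have "a3 \<otimes> (\<one> \<oplus> b \<otimes> a1) = a2 \<otimes> ((\<one> \<oplus> w) \<otimes> (\<one> \<oplus> b \<otimes> a1))"
      using a b w by (simp only: m_assoc U_carrier C_U B_simps a_closed one_closed m_closed)
    then show ?thesis using wl a by simp
  qed
  have 1: "a3 \<otimes> b \<oplus> (a3 \<otimes> b) \<otimes> (a1 \<otimes> b) = a2 \<otimes> b"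
    using a a3 b arg_cong[OF a3', of "\<lambda>x. x \<otimes> b"] by (simp add: l_distr r_distr m_assoc)
  have 2: "b \<otimes> a3 \<oplus> (b \<otimes> a3) \<otimes> (b \<otimes> a1) = b \<otimes> a2"
    using a a3 b arg_cong[OF a3', of "\<lambda>x. b \<otimes> x"] by (simp add: l_distr r_distr m_assoc)
  have "\<psi> ((a1 \<oplus> a2) \<otimes> b) = \<psi> (a3 \<otimes> b) * \<psi> (a1 \<otimes> b)"
    using a a3 b by (simp add: \<psi>_mult[symmetric] l_distr 1[symmetric] a_ac)
  moreover have "\<psi> (b \<otimes> (a1 \<oplus> a2)) = \<psi> (b \<otimes> a3) * \<psi> (b \<otimes> a1)"
    using a a3 b by (simp add: \<psi>_mult[symmetric] r_distr 2[symmetric] a_ac)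
  ultimately have "pairing (a1 \<oplus> a2) b = pairing a1 b * pairing a3 b"
    by (simp add: pairing_def mult.commute)
  then show ?thesis using w unfolding a3_def by blast
qed

text \<open>With \<open>a \<otimes> z\<close> as second summand, the twisted argument is again a
  multiple of \<open>a\<close>, namely \<open>a \<otimes> (z \<oplus> z \<otimes> w)\<close>, and
  \<open>pairing_product\<close> removes it. This in turn removes the twist in general.\<close>

lemma pairing_add_product:
  assumes a: "a \<in> U" "z \<in> U" and b: "b \<in> B"
  shows "pairing (a \<oplus> a \<otimes> z) b = pairing a b"
proof -
  obtain w where w: "w \<in> C"
    and e: "pairing (a \<oplus> a \<otimes> z) b = pairing a b * pairing (a \<otimes> z \<oplus> a \<otimes> z \<otimes> w) b"
    using pairing_add_twisted[of a "a \<otimes> z" b] a b by auto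
  have "a \<otimes> z \<oplus> a \<otimes> z \<otimes> w = a \<otimes> (z \<oplus> z \<otimes> w)"
    using a w by (simp add: r_distr m_assoc)
  then show ?thesis using e a b w by (simp add: pairing_product)
qed

lemma pairing_add:
  assumes "a1 \<in> U" "a2 \<in> U" "b \<in> B"
  shows "pairing (a1 \<oplus> a2) b = pairing a1 b * pairing a2 b"
  using pairing_add_twisted[OF assms] assms by (auto simp: pairing_add_product)

text \<open>Both products are written over the common factor \<open>s = 1 + x + b\<close>. With
  \<open>W\<close> inverse to \<open>s\<close>, \<open>(1 + x)(1 + b) = (1 + x b W) s\<close> and
  \<open>(1 + b)(1 + x) = (1 + b x W) s\<close>, so the two images differ by
  \<open>\<psi>(x b W) / \<psi>(b x W)\<close>. The inverse \<open>W\<close> drops out because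
  \<open>pairing (x W) b = pairing x b\<close> and
  \<open>\<psi>(x W b) = \<psi>(x b W)\<close>.\<close>

lemma \<sigma>_commutator:
  assumes x: "x \<in> U" and b: "b \<in> B"
  shows "\<sigma> (\<one> \<oplus> x) * \<sigma> (\<one> \<oplus> b) = pairing x b \<cdot>\<^sub>f (\<sigma> (\<one> \<oplus> b) * \<sigma> (\<one> \<oplus> x))"
proof -
  define s where "s = \<one> \<oplus> (x \<oplus> b)"
  have xb: "x \<oplus> b \<in> U" using x b by simp
  obtain z where z: "z \<in> U" and zr: "s \<otimes> (\<one> \<oplus> z) = \<one>" and zl: "(\<one> \<oplus> z) \<otimes> s = \<one>"
    using nilpotent_subring_inverse[OF U finU xb] unfolding s_def by metis
  define W where "W = \<one> \<oplus> z"
  have W: "W \<in> carrier R" "s \<otimes> W = \<one>" "W \<otimes> s = \<one>" "s \<in> carrier R"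
    using z zr zl x b by (auto simp: W_def s_def)
  have xW: "x \<otimes> W \<in> U" "b \<otimes> W \<in> U"
    using x b z by (simp_all add: W_def r_distr)
  have C1: "x \<otimes> b \<otimes> W \<in> C" using x b z by (simp add: W_def r_distr)
  have C2: "b \<otimes> x \<otimes> W \<in> C" using x b z by (simp add: W_def r_distr)
  have C3: "x \<otimes> W \<otimes> b \<in> C" using xW b by simp
  \<comment> \<open>Both \<open>s W b\<close> and \<open>b W s\<close> equal \<open>b\<close>.
    Expanding \<open>s = (1 + x) + b\<close> in each and cancelling \<open>b W b\<close> gives the
    claim.\<close>
  have key: "(\<one> \<oplus> x) \<otimes> W \<otimes> b = b \<otimes> W \<otimes> (\<one> \<oplus> x)"
  proof -
    have s: "s = (\<one> \<oplus> x) \<oplus> b" using x b by (simp add: s_def a_assoc)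
    have "(\<one> \<oplus> x) \<otimes> W \<otimes> b \<oplus> b \<otimes> W \<otimes> b = s \<otimes> W \<otimes> b"
      using x b W(1) by (simp add: s l_distr)
    also have "\<dots> = b \<otimes> W \<otimes> s"
      using W x b by (simp add: m_assoc)
    also have "\<dots> = b \<otimes> W \<otimes> (\<one> \<oplus> x) \<oplus> b \<otimes> W \<otimes> b"
      using x b W(1) by (simp add: s r_distr)
    finally show ?thesis
      using x b W(1) by simp
  qed
  \<comment> \<open>By \<open>key\<close>, \<open>1 + x\<close> conjugates \<open>1 + x W b\<close>
    into \<open>1 + x b W\<close>.\<close>
  have "\<psi> (x \<otimes> W \<otimes> b) = \<psi> (x \<otimes> b \<otimes> W)"
  proof (rule \<psi>_conj[OF C3 C1 x])
    have "(\<one> \<oplus> x) \<otimes> (\<one> \<oplus> x \<otimes> W \<otimes> b) = (\<one> \<oplus> x) \<oplus> x \<otimes> ((\<one> \<oplus> x) \<otimes> W \<otimes> b)"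
      using x b W(1) by (simp add: l_distr r_distr m_assoc a_ac)
    also have "\<dots> = (\<one> \<oplus> x \<otimes> b \<otimes> W) \<otimes> (\<one> \<oplus> x)"
      unfolding key using x b W(1) by (simp add: l_distr r_distr m_assoc a_ac)
    finally show "(\<one> \<oplus> x) \<otimes> (\<one> \<oplus> x \<otimes> W \<otimes> b) = (\<one> \<oplus> x \<otimes> b \<otimes> W) \<otimes> (\<one> \<oplus> x)" .
  qed
  then have pair: "pairing x b * \<psi> (b \<otimes> x \<otimes> W) = \<psi> (x \<otimes> b \<otimes> W)"
  proof -
    have "x \<otimes> W = x \<oplus> x \<otimes> z" using x z by (simp add: W_def r_distr)
    then have "pairing x b = pairing (x \<otimes> W) b"
      using x b z by (simp add: pairing_add_product)
    moreover have "b \<otimes> (x \<otimes> W) = b \<otimes> x \<otimes> W" using x b W(1) by (simp add: m_assoc)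
    ultimately show ?thesis
      using \<open>\<psi> (x \<otimes> W \<otimes> b) = \<psi> (x \<otimes> b \<otimes> W)\<close> \<psi>_nonzero[OF C2] by (simp add: pairing_def)
  qed
  have "(\<one> \<oplus> x \<otimes> b \<otimes> W) \<otimes> s = s \<oplus> x \<otimes> b"
    using x b W by (simp add: l_distr m_assoc)
  also have "\<dots> = (\<one> \<oplus> x) \<otimes> (\<one> \<oplus> b)"
    using x b by (simp add: s_def l_distr r_distr a_ac)
  finally have p1: "(\<one> \<oplus> x) \<otimes> (\<one> \<oplus> b) = (\<one> \<oplus> x \<otimes> b \<otimes> W) \<otimes> s" by simp
  have "(\<one> \<oplus> b \<otimes> x \<otimes> W) \<otimes> s = s \<oplus> b \<otimes> x"
    using x b W by (simp add: l_distr m_assoc)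
  also have "\<dots> = (\<one> \<oplus> b) \<otimes> (\<one> \<oplus> x)"
    using x b by (simp add: s_def l_distr r_distr a_ac)
  finally have p2: "(\<one> \<oplus> b) \<otimes> (\<one> \<oplus> x) = (\<one> \<oplus> b \<otimes> x \<otimes> W) \<otimes> s" by simp
  have "\<sigma> (\<one> \<oplus> x) * \<sigma> (\<one> \<oplus> b) = \<sigma> ((\<one> \<oplus> x) \<otimes> (\<one> \<oplus> b))"
    using x b by (simp add: \<sigma>_mult one_plus_I)
  also have "\<dots> = \<psi> (x \<otimes> b \<otimes> W) \<cdot>\<^sub>f \<sigma> s"
    unfolding p1 s_def by (rule \<sigma>_C_mult[OF C1 xb])
  also have "\<dots> = pairing x b \<cdot>\<^sub>f \<sigma> ((\<one> \<oplus> b) \<otimes> (\<one> \<oplus> x))"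
    unfolding p2 s_def \<sigma>_C_mult(1)[OF C2 xb] by (simp add: pair)
  also have "\<dots> = pairing x b \<cdot>\<^sub>f (\<sigma> (\<one> \<oplus> b) * \<sigma> (\<one> \<oplus> x))"
    using x b by (simp add: \<sigma>_mult one_plus_I)
  finally show ?thesis .
qed

end

context scalar_ideal
begin

lemma pairing_eq_1: "a \<otimes> b = b \<otimes> a \<Longrightarrow> a \<in> U \<Longrightarrow> b \<in> B \<Longrightarrow> pairing a b = 1"
  using \<psi>_nonzero[of "b \<otimes> a"] by (simp add: pairing_def)

lemma pairing_minus:
  assumes "a \<in> U" "b \<in> B" "pairing a b = 1"
  shows "pairing (\<ominus> a) b = 1"
proof -
  have "pairing a b * pairing (\<ominus> a) b = pairing \<zero> b"
    using assms(1,2) by (simp add: pairing_add[symmetric] r_neg)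
  moreover have "pairing \<zero> b = 1"
    using assms(2) by (intro pairing_eq_1) simp_all
  ultimately show ?thesis using assms(3) by simp
qed

text \<open>The witness is \<open>d = c (1 + b)^{-1}\<close>, which stays in the ideal. Hence adding
  an element of \<open>C\<close> changes \<open>\<sigma> (\<one> \<oplus> b)\<close> only by a
  scalar.\<close>

lemma one_plus_add_C:
  assumes b: "b \<in> U" and c: "c \<in> C"
  shows "\<exists>d\<in>C. \<one> \<oplus> (b \<oplus> c) = (\<one> \<oplus> d) \<otimes> (\<one> \<oplus> b)"
proof -
  obtain v where v: "v \<in> U" "(\<one> \<oplus> v) \<otimes> (\<one> \<oplus> b) = \<one>"
    using nilpotent_subring_inverse[OF U finU b] by metis
  have "(\<one> \<oplus> (c \<oplus> c \<otimes> v)) \<otimes> (\<one> \<oplus> b) = (\<one> \<oplus> b) \<oplus> c \<otimes> ((\<one> \<oplus> v) \<otimes> (\<one> \<oplus> b))"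
    using b c v(1) by (simp add: l_distr r_distr m_assoc a_ac)
  then have "\<one> \<oplus> (b \<oplus> c) = (\<one> \<oplus> (c \<oplus> c \<otimes> v)) \<otimes> (\<one> \<oplus> b)"
    using b c v by (simp add: a_assoc)
  then show ?thesis using b c v by (intro bexI[of _ "c \<oplus> c \<otimes> v"]) auto
qed

lemma B_add_C: "b \<in> B \<Longrightarrow> c \<in> C \<Longrightarrow> b \<oplus> c \<in> B"
  unfolding B_def by (simp add: l_distr r_distr)

text \<open>The last nonzero power of \<open>U\<close> modulo \<open>C\<close> consists of elements of \<open>B\<close>.\<close>

lemma ex_B_not_C:
  assumes "C \<noteq> U"
  shows "\<exists>y\<in>B. y \<notin> C"
proof -
  define k where "k = (LEAST k. products R U k \<subseteq> C)"
  have "\<exists>k. products R U k \<subseteq> C"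
    using nilpotent_subringD(6)[OF U] C_zero by blast
  then have k: "products R U k \<subseteq> C"
    unfolding k_def by (rule LeastI_ex)
  \<comment> \<open>Index \<open>0\<close> gives \<open>U\<close> itself, which is not contained in
    \<open>C\<close>.\<close>
  have "k \<noteq> 0" using k assms C_U by auto
  then obtain m where m: "k = Suc m" using not0_implies_Suc by blast
  then have "\<not> products R U m \<subseteq> C"
    using not_less_Least[of m "\<lambda>k. products R U k \<subseteq> C"] by (simp add: k_def[symmetric])
  then obtain y where y: "y \<in> products R U m" "y \<notin> C" by blast
  have "u \<otimes> y \<in> C" "y \<otimes> u \<in> C" if "u \<in> U" for u
  proof -
    show "u \<otimes> y \<in> C" using products_mult_left[OF U that y(1)] k m by blast
    have "y \<otimes> u \<in> products R U k" using that y(1) by (auto simp: m)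
    then show "y \<otimes> u \<in> C" using k by blast
  qed
  moreover have "y \<in> U" using y(1) products_closed[OF U] by blast
  ultimately have "y \<in> B" unfolding B_def by blast
  then show ?thesis using y(2) by blast
qed

end

section \<open>The induction over nilpotent algebras\<close>

text \<open>If all \<open>\<sigma> g\<close> are scalar, every \<open>M\<close> cut down by
  \<open>\<sigma> \<one>\<close> commutes with them, so Schur makes \<open>\<sigma> \<one>\<close> a
  minimal idempotent, of trace one. The conclusion is phrased as induction from the whole group to
  give the base case the shape of the general claim.\<close>

lemma irreducible_scalar_rep_induced:
  assumes G: "group G" and fin: "finite (carrier G)"
    and irr: "irreducible_fmat_rep G \<sigma>"
    and \<psi>: "\<And>g. g \<in> carrier G \<Longrightarrow> \<sigma> g = \<psi> g \<cdot>\<^sub>f \<sigma> \<one>\<^bsub>G\<^esub>"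
    and g: "g \<in> carrier G"
  shows "ftrace (\<sigma> g) = induced_character G (carrier G) \<psi> g"
proof -
  interpret group G by fact
  have hom: "\<And>x y. x \<in> carrier G \<Longrightarrow> y \<in> carrier G \<Longrightarrow> \<sigma> (x \<otimes>\<^bsub>G\<^esub> y) = \<sigma> x * \<sigma> y"
    and nz: "\<sigma> \<one>\<^bsub>G\<^esub> \<noteq> 0"
    and schur: "\<And>M. \<sigma> \<one>\<^bsub>G\<^esub> * M * \<sigma> \<one>\<^bsub>G\<^esub> = M \<Longrightarrow> (\<And>g. g \<in> carrier G \<Longrightarrow> M * \<sigma> g = \<sigma> g * M) \<Longrightarrow>
      \<exists>c. M = c \<cdot>\<^sub>f \<sigma> \<one>\<^bsub>G\<^esub>"
    using irr unfolding irreducible_fmat_rep_def by blast+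
  have ee: "\<sigma> \<one>\<^bsub>G\<^esub> * \<sigma> \<one>\<^bsub>G\<^esub> = \<sigma> \<one>\<^bsub>G\<^esub>" using hom[of "\<one>\<^bsub>G\<^esub>" "\<one>\<^bsub>G\<^esub>"] by simp
  have tr: "ftrace (\<sigma> \<one>\<^bsub>G\<^esub>) = 1"
  proof (rule ftrace_minimal_idempotent[OF ee nz])
    fix M assume M: "\<sigma> \<one>\<^bsub>G\<^esub> * M * \<sigma> \<one>\<^bsub>G\<^esub> = M"
    have eM: "\<sigma> \<one>\<^bsub>G\<^esub> * M = M * \<sigma> \<one>\<^bsub>G\<^esub>"
    proof -
      have "\<sigma> \<one>\<^bsub>G\<^esub> * (\<sigma> \<one>\<^bsub>G\<^esub> * M * \<sigma> \<one>\<^bsub>G\<^esub>) = \<sigma> \<one>\<^bsub>G\<^esub> * M * \<sigma> \<one>\<^bsub>G\<^esub>"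
        by (simp add: mult.assoc[symmetric] ee)
      moreover have "(\<sigma> \<one>\<^bsub>G\<^esub> * M * \<sigma> \<one>\<^bsub>G\<^esub>) * \<sigma> \<one>\<^bsub>G\<^esub> = \<sigma> \<one>\<^bsub>G\<^esub> * M * \<sigma> \<one>\<^bsub>G\<^esub>"
        by (simp add: mult.assoc ee)
      ultimately show ?thesis unfolding M by simp
    qed
    show "\<exists>c. M = c \<cdot>\<^sub>f \<sigma> \<one>\<^bsub>G\<^esub>"
    proof (rule schur[OF M])
      fix h assume "h \<in> carrier G"
      then have "\<sigma> h = \<psi> h \<cdot>\<^sub>f \<sigma> \<one>\<^bsub>G\<^esub>" by (rule \<psi>)
      then show "M * \<sigma> h = \<sigma> h * M" by (simp only: fscale_times eM)
    qed
  qed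
  have conj: "\<psi> (inv\<^bsub>G\<^esub> x \<otimes>\<^bsub>G\<^esub> g \<otimes>\<^bsub>G\<^esub> x) = \<psi> g" if x: "x \<in> carrier G" for x
  proof -
    have "\<sigma> g * \<sigma> x = \<sigma> x * \<sigma> g"
      by (subst (1 2) \<psi>[OF g], subst (1 2) \<psi>[OF x]) (simp add: mult.commute)
    then have "\<sigma> (inv\<^bsub>G\<^esub> x \<otimes>\<^bsub>G\<^esub> g \<otimes>\<^bsub>G\<^esub> x) = \<sigma> (inv\<^bsub>G\<^esub> x \<otimes>\<^bsub>G\<^esub> x \<otimes>\<^bsub>G\<^esub> g)"
      using x g by (simp only: hom mult.assoc inv_closed m_closed)
    also have "\<dots> = \<sigma> g" using x g by simp
    finally have "\<psi> (inv\<^bsub>G\<^esub> x \<otimes>\<^bsub>G\<^esub> g \<otimes>\<^bsub>G\<^esub> x) \<cdot>\<^sub>f \<sigma> \<one>\<^bsub>G\<^esub> = \<psi> g \<cdot>\<^sub>f \<sigma> \<one>\<^bsub>G\<^esub>"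
      using \<psi>[of "inv\<^bsub>G\<^esub> x \<otimes>\<^bsub>G\<^esub> g \<otimes>\<^bsub>G\<^esub> x"] \<psi>[OF g] x g by (simp only: inv_closed m_closed)
    then show ?thesis using nz fscale_cancel by blast
  qed
  have "ftrace (\<sigma> g) = \<psi> g" using \<psi>[OF g] tr by (simp add: ftrace_scale)
  moreover have "induced_character G (carrier G) \<psi> g = (\<Sum>x\<in>carrier G. \<psi> g) / of_nat (card (carrier G))"
    unfolding induced_character_eq[OF fin] using g conj
    by (intro arg_cong2[where f = "(/)"] sum.cong) auto
  moreover have "card (carrier G) \<noteq> 0" using fin one_closed by auto
  ultimately show ?thesis by simp
qed

text \<open>The claim concerns every finite nilpotent \<open>U\<close> closed under the field,
  because the induction replaces the radical by the subalgebra \<open>S\<close>. The linear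
  character is kept as a multiplicative function \<open>\<phi>\<close> until the end.\<close>

lemma (in assoc_algebra) irreducible_fmat_rep_monomial:
  assumes "nilpotent_subring A U" "finite U"
    and "\<And>c u. c \<in> carrier F \<Longrightarrow> u \<in> U \<Longrightarrow> c \<odot>\<^bsub>A\<^esub> u \<in> U"
    and "irreducible_fmat_rep (unit_group A U) \<sigma>"
  shows "\<exists>V \<phi>. V \<subseteq> U \<and> nilpotent_subring A V \<and> (\<forall>c\<in>carrier F. \<forall>v\<in>V. c \<odot>\<^bsub>A\<^esub> v \<in> V) \<and>
    (\<forall>x\<in>one_plus A V. \<forall>y\<in>one_plus A V. \<phi> (x \<otimes>\<^bsub>A\<^esub> y) = \<phi> x * \<phi> y) \<and> \<phi> \<one>\<^bsub>A\<^esub> = (1 :: complex) \<and>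
    (\<forall>g\<in>one_plus A U. ftrace (\<sigma> g) = induced_character (unit_group A U) (one_plus A V) \<phi> g)"
  using assms
proof (induction "card U" arbitrary: U \<sigma> rule: less_induct)
  case (less U \<sigma>)
  note finU = \<open>finite U\<close> and nilU = \<open>nilpotent_subring A U\<close> and smU = less.prems(3)
  have AG: "abelian_group A" "abelian_monoid A"
    using ring_axioms by (simp_all add: ring_def abelian_group_def)
  interpret G: group "unit_group A U" using nilU finU by (rule group_unit_group)
  note UD = nilpotent_subringD[OF nilU]
  have Uc: "u \<in> carrier A" if "u \<in> U" for u using that UD(1) by blast
  have hom: "\<And>x y. x \<in> one_plus A U \<Longrightarrow> y \<in> one_plus A U \<Longrightarrow> \<sigma> (x \<otimes>\<^bsub>A\<^esub> y) = \<sigma> x * \<sigma> y"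
    and nz: "\<sigma> \<one>\<^bsub>A\<^esub> \<noteq> 0"
    and schur: "\<And>M. \<sigma> \<one>\<^bsub>A\<^esub> * M * \<sigma> \<one>\<^bsub>A\<^esub> = M \<Longrightarrow> (\<And>g. g \<in> one_plus A U \<Longrightarrow> M * \<sigma> g = \<sigma> g * M) \<Longrightarrow>
      \<exists>c. M = c \<cdot>\<^sub>f \<sigma> \<one>\<^bsub>A\<^esub>"
    using less.prems(4) unfolding irreducible_fmat_rep_def unit_group_simps by blast+
  have finG: "finite (carrier (unit_group A U))" using finite_one_plus[OF finU] by simp
  \<comment> \<open>These are the conditions of \<open>scalar_ideal\<close> on an ideal of the ring
    \<open>U\<close>. The zero ideal satisfies them, so finiteness gives a maximal one; maximality
    is used only to exclude \<open>S = U\<close>.\<close>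
  define scalar_on where "scalar_on C \<longleftrightarrow> C \<subseteq> U \<and> \<zero>\<^bsub>A\<^esub> \<in> C \<and>
    (\<forall>c\<in>C. \<forall>d\<in>C. c \<oplus>\<^bsub>A\<^esub> d \<in> C) \<and> (\<forall>c\<in>C. \<ominus>\<^bsub>A\<^esub> c \<in> C) \<and>
    (\<forall>c\<in>C. \<forall>u\<in>U. u \<otimes>\<^bsub>A\<^esub> c \<in> C \<and> c \<otimes>\<^bsub>A\<^esub> u \<in> C) \<and>
    (\<forall>c\<in>C. \<exists>k. \<sigma> (\<one>\<^bsub>A\<^esub> \<oplus>\<^bsub>A\<^esub> c) = k \<cdot>\<^sub>f \<sigma> \<one>\<^bsub>A\<^esub>)" for C
  have "finite {C. scalar_on C}"
    by (rule finite_subset[of _ "Pow U"]) (use finU in \<open>auto simp: scalar_on_def\<close>)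
  moreover have "scalar_on {\<zero>\<^bsub>A\<^esub>}"
    using UD(2) Uc by (auto simp: scalar_on_def intro: exI[of _ 1])
  ultimately obtain C where C: "scalar_on C" and Cmax: "\<And>D. scalar_on D \<Longrightarrow> C \<subseteq> D \<Longrightarrow> D = C"
    using finite_has_maximal[of "{C. scalar_on C}"] by blast
  have "\<forall>c\<in>C. \<exists>k. \<sigma> (\<one>\<^bsub>A\<^esub> \<oplus>\<^bsub>A\<^esub> c) = k \<cdot>\<^sub>f \<sigma> \<one>\<^bsub>A\<^esub>"
    using C unfolding scalar_on_def by blast
  then obtain \<psi> where \<psi>: "\<And>c. c \<in> C \<Longrightarrow> \<sigma> (\<one>\<^bsub>A\<^esub> \<oplus>\<^bsub>A\<^esub> c) = \<psi> c \<cdot>\<^sub>f \<sigma> \<one>\<^bsub>A\<^esub>"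
    unfolding bchoice_iff by blast
  interpret S: scalar_ideal A U C \<sigma> \<psi>
    by unfold_locales (use C nilU finU hom nz \<psi> in \<open>auto simp: scalar_on_def\<close>)
  show ?case
  proof (cases "C = U")
    case True
    have "\<exists>k. \<sigma> g = k \<cdot>\<^sub>f \<sigma> \<one>\<^bsub>A\<^esub>" if "g \<in> one_plus A U" for g
      using that \<psi> True by (auto elim: one_plus_E)
    then have "\<forall>g\<in>one_plus A U. \<exists>k. \<sigma> g = k \<cdot>\<^sub>f \<sigma> \<one>\<^bsub>A\<^esub>" by blast
    then obtain \<phi> where \<phi>: "\<And>g. g \<in> one_plus A U \<Longrightarrow> \<sigma> g = \<phi> g \<cdot>\<^sub>f \<sigma> \<one>\<^bsub>A\<^esub>"
      unfolding bchoice_iff by blast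
    have mult: "\<phi> (x \<otimes>\<^bsub>A\<^esub> y) = \<phi> x * \<phi> y" if xy: "x \<in> one_plus A U" "y \<in> one_plus A U" for x y
    proof -
      have "x \<otimes>\<^bsub>A\<^esub> y \<in> one_plus A U" using G.m_closed xy by simp
      then have "\<phi> (x \<otimes>\<^bsub>A\<^esub> y) \<cdot>\<^sub>f \<sigma> \<one>\<^bsub>A\<^esub> = \<sigma> x * \<sigma> y"
        by (subst \<phi>[symmetric]) (simp_all only: hom[OF xy])
      also have "\<dots> = (\<phi> x \<cdot>\<^sub>f \<sigma> \<one>\<^bsub>A\<^esub>) * (\<phi> y \<cdot>\<^sub>f \<sigma> \<one>\<^bsub>A\<^esub>)"
        by (subst \<phi>[OF xy(1)], subst \<phi>[OF xy(2)]) (rule refl)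
      also have "\<dots> = (\<phi> x * \<phi> y) \<cdot>\<^sub>f \<sigma> \<one>\<^bsub>A\<^esub>" using S.\<sigma>_mult_one(1)[OF S.one_in] by (simp add: mult.commute)
      finally show ?thesis using nz fscale_cancel by blast
    qed
    have one: "\<phi> \<one>\<^bsub>A\<^esub> = 1"
      using \<phi>[OF S.one_in] nz fscale_cancel[of "\<sigma> \<one>\<^bsub>A\<^esub>" 1 "\<phi> \<one>\<^bsub>A\<^esub>"] by simp
    have "ftrace (\<sigma> g) = induced_character (unit_group A U) (one_plus A U) \<phi> g" if "g \<in> one_plus A U" for g
      using irreducible_scalar_rep_induced[OF G.group_axioms finG less.prems(4), of \<phi> g] \<phi> that by simp
    then show ?thesis
      using nilU smU mult one by (intro exI[of _ U] exI[of _ \<phi>]) auto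
  next
    case False
    then obtain y where y: "y \<in> S.B" "y \<notin> C" using S.ex_B_not_C by blast
    then have yc: "y \<in> carrier A" by (simp add: Uc)
    have left: "(c \<odot>\<^bsub>A\<^esub> u) \<otimes>\<^bsub>A\<^esub> v = u \<otimes>\<^bsub>A\<^esub> (c \<odot>\<^bsub>A\<^esub> v)"
      if "c \<in> carrier F" "u \<in> carrier A" "v \<in> carrier A" for c u v
      using that by (simp add: smult_mult_left smult_mult_right)
    have tyB: "t \<odot>\<^bsub>A\<^esub> y \<in> S.B" if t: "t \<in> carrier F" for t
    proof -
      have "u \<otimes>\<^bsub>A\<^esub> (t \<odot>\<^bsub>A\<^esub> y) \<in> C" "(t \<odot>\<^bsub>A\<^esub> y) \<otimes>\<^bsub>A\<^esub> u \<in> C" if "u \<in> U" for u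
        using S.B_simps(2,3)[OF y(1) smU[OF t that]] left[of t u y] left[of t y u] t that yc
        by (simp_all add: Uc)
      then show ?thesis using smU[OF t, of y] y(1) unfolding S.B_def by simp
    qed
    \<comment> \<open>Conjugation by \<open>1 + a\<close> multiplies
      \<open>\<sigma> (1 + t y)\<close> by a pairing value, so triviality for all \<open>t\<close>
      means that \<open>1 + a\<close> fixes each joint eigencharacter.\<close>
    define S where "S = {a \<in> U. \<forall>t\<in>carrier F. S.pairing a (t \<odot>\<^bsub>A\<^esub> y) = 1}"
    have SU: "S \<subseteq> U" by (auto simp: S_def)
    have nilS: "nilpotent_subring A S"
    proof (rule nilpotent_subring_subset[OF nilU SU])
      show "\<zero>\<^bsub>A\<^esub> \<in> S"
        using tyB by (auto simp: S_def intro!: S.pairing_eq_1)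
      show "u \<oplus>\<^bsub>A\<^esub> v \<in> S \<and> u \<otimes>\<^bsub>A\<^esub> v \<in> S" if "u \<in> S" "v \<in> S" for u v
        using that tyB by (simp add: S_def S.pairing_add S.pairing_product)
      show "\<ominus>\<^bsub>A\<^esub> u \<in> S" if "u \<in> S" for u
        using that tyB by (simp add: S_def S.pairing_minus)
    qed
    have smS: "c \<odot>\<^bsub>A\<^esub> u \<in> S" if c: "c \<in> carrier F" and u: "u \<in> S" for c u
    proof -
      have u': "u \<in> U" "u \<in> carrier A" using u SU Uc by auto
      have "S.pairing (c \<odot>\<^bsub>A\<^esub> u) (t \<odot>\<^bsub>A\<^esub> y) = 1" if t: "t \<in> carrier F" for t
      proof -
        have ct: "c \<otimes>\<^bsub>F\<^esub> t \<in> carrier F" using c t by simp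
        have "(c \<odot>\<^bsub>A\<^esub> u) \<otimes>\<^bsub>A\<^esub> (t \<odot>\<^bsub>A\<^esub> y) = u \<otimes>\<^bsub>A\<^esub> ((c \<otimes>\<^bsub>F\<^esub> t) \<odot>\<^bsub>A\<^esub> y)"
          using c t u' yc by (simp add: left smult_assoc1)
        moreover have "(t \<odot>\<^bsub>A\<^esub> y) \<otimes>\<^bsub>A\<^esub> (c \<odot>\<^bsub>A\<^esub> u) = ((c \<otimes>\<^bsub>F\<^esub> t) \<odot>\<^bsub>A\<^esub> y) \<otimes>\<^bsub>A\<^esub> u"
          using c t u' yc by (simp add: left[symmetric] smult_assoc1)
        ultimately have "S.pairing (c \<odot>\<^bsub>A\<^esub> u) (t \<odot>\<^bsub>A\<^esub> y) = S.pairing u ((c \<otimes>\<^bsub>F\<^esub> t) \<odot>\<^bsub>A\<^esub> y)"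
          by (simp add: S.pairing_def)
        then show ?thesis using u ct by (simp add: S_def)
      qed
      then show ?thesis using smU[OF c] u' by (simp add: S_def)
    qed
    have comm: "\<sigma> (\<one>\<^bsub>A\<^esub> \<oplus>\<^bsub>A\<^esub> u) * \<sigma> (\<one>\<^bsub>A\<^esub> \<oplus>\<^bsub>A\<^esub> t \<odot>\<^bsub>A\<^esub> y) = \<sigma> (\<one>\<^bsub>A\<^esub> \<oplus>\<^bsub>A\<^esub> t \<odot>\<^bsub>A\<^esub> y) * \<sigma> (\<one>\<^bsub>A\<^esub> \<oplus>\<^bsub>A\<^esub> u)"
      if "u \<in> S" "t \<in> carrier F" for u t
      using that S.\<sigma>_commutator[of u "t \<odot>\<^bsub>A\<^esub> y"] tyB by (simp add: S_def)
    have "S \<noteq> U"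
    proof
      assume SU': "S = U"
      \<comment> \<open>A strictly larger ideal on which \<open>\<sigma>\<close> would still be
        scalar. Multiplication by \<open>U\<close> takes \<open>D\<close> into \<open>C\<close>,
        since \<open>D\<close> lies in \<open>B\<close>. If \<open>S = U\<close>, each
        \<open>\<sigma> (1 + t y)\<close> commutes with the whole image, so it is scalar by Schur,
        and \<open>one_plus_add_C\<close> extends this to all of \<open>1 + D\<close>.\<close>
      define D where "D = {t \<odot>\<^bsub>A\<^esub> y \<oplus>\<^bsub>A\<^esub> c | t c. t \<in> carrier F \<and> c \<in> C}"
      have DB: "D \<subseteq> S.B" using tyB S.B_add_C by (auto simp: D_def)
      have DI: "t \<odot>\<^bsub>A\<^esub> y \<oplus>\<^bsub>A\<^esub> c \<in> D" if "t \<in> carrier F" "c \<in> C" for t c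
        using that by (auto simp: D_def)
      have CD: "C \<subseteq> D"
      proof
        fix c assume "c \<in> C"
        then show "c \<in> D" using DI[of "\<zero>\<^bsub>F\<^esub>" c] yc by (simp add: Uc)
      qed
      have "scalar_on D" unfolding scalar_on_def
      proof (intro conjI ballI)
        show "D \<subseteq> U" using DB S.B_simps(1) by blast
        show "\<zero>\<^bsub>A\<^esub> \<in> D" using CD S.C_zero by blast
        show "u \<otimes>\<^bsub>A\<^esub> d \<in> D" "d \<otimes>\<^bsub>A\<^esub> u \<in> D" if "d \<in> D" "u \<in> U" for d u
          using that DB CD S.B_simps(2,3) by blast+
        fix d assume "d \<in> D"
        then obtain t c where d: "d = t \<odot>\<^bsub>A\<^esub> y \<oplus>\<^bsub>A\<^esub> c" "t \<in> carrier F" "c \<in> C"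
          by (auto simp: D_def)
        have "\<ominus>\<^bsub>A\<^esub> d = (\<ominus>\<^bsub>F\<^esub> t) \<odot>\<^bsub>A\<^esub> y \<oplus>\<^bsub>A\<^esub> \<ominus>\<^bsub>A\<^esub> c"
          using d yc by (simp add: Uc smult_l_minus abelian_group.minus_add[OF AG(1)])
        then show "\<ominus>\<^bsub>A\<^esub> d \<in> D" using DI[of "\<ominus>\<^bsub>F\<^esub> t" "\<ominus>\<^bsub>A\<^esub> c"] d by simp
        show "d \<oplus>\<^bsub>A\<^esub> e \<in> D" if "e \<in> D" for e
        proof -
          obtain s b where e: "e = s \<odot>\<^bsub>A\<^esub> y \<oplus>\<^bsub>A\<^esub> b" "s \<in> carrier F" "b \<in> C"
            using \<open>e \<in> D\<close> by (auto simp: D_def)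
          have "d \<oplus>\<^bsub>A\<^esub> e = (t \<oplus>\<^bsub>F\<^esub> s) \<odot>\<^bsub>A\<^esub> y \<oplus>\<^bsub>A\<^esub> (c \<oplus>\<^bsub>A\<^esub> b)"
            using d e yc by (simp add: Uc smult_l_distr abelian_monoid.a_ac[OF AG(2)])
          then show ?thesis using DI[of "t \<oplus>\<^bsub>F\<^esub> s" "c \<oplus>\<^bsub>A\<^esub> b"] d e by simp
        qed
        define n where "n = \<one>\<^bsub>A\<^esub> \<oplus>\<^bsub>A\<^esub> t \<odot>\<^bsub>A\<^esub> y"
        have tyU: "t \<odot>\<^bsub>A\<^esub> y \<in> U" using tyB[OF d(2)] by simp
        then have n: "n \<in> one_plus A U" unfolding n_def by (rule one_plus_I)
        have "\<exists>k. \<sigma> n = k \<cdot>\<^sub>f \<sigma> \<one>\<^bsub>A\<^esub>"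
        proof (rule schur)
          show "\<sigma> \<one>\<^bsub>A\<^esub> * \<sigma> n * \<sigma> \<one>\<^bsub>A\<^esub> = \<sigma> n" using n by simp
          show "\<sigma> n * \<sigma> g = \<sigma> g * \<sigma> n" if "g \<in> one_plus A U" for g
            using that comm d(2) unfolding n_def SU' by (metis one_plus_E)
        qed
        then obtain k where k: "\<sigma> n = k \<cdot>\<^sub>f \<sigma> \<one>\<^bsub>A\<^esub>" ..
        obtain c' where c': "c' \<in> C" "\<one>\<^bsub>A\<^esub> \<oplus>\<^bsub>A\<^esub> d = (\<one>\<^bsub>A\<^esub> \<oplus>\<^bsub>A\<^esub> c') \<otimes>\<^bsub>A\<^esub> n"
          using S.one_plus_add_C[OF tyU d(3)] unfolding d(1) n_def by blast
        then have "\<sigma> (\<one>\<^bsub>A\<^esub> \<oplus>\<^bsub>A\<^esub> d) = (\<psi> c' * k) \<cdot>\<^sub>f \<sigma> \<one>\<^bsub>A\<^esub>"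
          using S.\<sigma>_C_mult(1)[OF c'(1) tyU] k unfolding n_def by simp
        then show "\<exists>k. \<sigma> (\<one>\<^bsub>A\<^esub> \<oplus>\<^bsub>A\<^esub> d) = k \<cdot>\<^sub>f \<sigma> \<one>\<^bsub>A\<^esub>" ..
      qed
      then have "D = C" using Cmax CD by blast
      moreover have "y \<in> D" using DI[of "\<one>\<^bsub>F\<^esub>" "\<zero>\<^bsub>A\<^esub>"] yc by simp
      ultimately show False using y by simp
    qed
    then have cardS: "card S < card U" using SU finU by (simp add: psubset_card_mono psubsetI)
    define N where "N = (\<lambda>t. \<one>\<^bsub>A\<^esub> \<oplus>\<^bsub>A\<^esub> t \<odot>\<^bsub>A\<^esub> y) ` carrier F"
    \<comment> \<open>Multiples of \<open>y\<close> commute in the ring, so their pairings are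
      trivial. Hence \<open>1 + F y\<close> lies in \<open>1 + S\<close>, and its images under
      \<open>\<sigma>\<close> commute with one another.\<close>
    have tyS: "t \<odot>\<^bsub>A\<^esub> y \<in> S" if t: "t \<in> carrier F" for t
    proof -
      have "(t \<odot>\<^bsub>A\<^esub> y) \<otimes>\<^bsub>A\<^esub> (s \<odot>\<^bsub>A\<^esub> y) = (s \<odot>\<^bsub>A\<^esub> y) \<otimes>\<^bsub>A\<^esub> (t \<odot>\<^bsub>A\<^esub> y)" if s: "s \<in> carrier F" for s
      proof -
        have "(t \<odot>\<^bsub>A\<^esub> y) \<otimes>\<^bsub>A\<^esub> (s \<odot>\<^bsub>A\<^esub> y) = s \<odot>\<^bsub>A\<^esub> ((t \<odot>\<^bsub>A\<^esub> y) \<otimes>\<^bsub>A\<^esub> y)"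
          using s t yc by (simp add: smult_mult_right)
        also have "(t \<odot>\<^bsub>A\<^esub> y) \<otimes>\<^bsub>A\<^esub> y = y \<otimes>\<^bsub>A\<^esub> (t \<odot>\<^bsub>A\<^esub> y)"
          using t yc by (intro left)
        finally show ?thesis using s t yc by (simp add: smult_mult_left)
      qed
      then show ?thesis using tyB t by (auto simp: S_def intro!: S.pairing_eq_1)
    qed
    have NU: "N \<subseteq> one_plus A U" using tyS SU by (auto simp: N_def intro: one_plus_I)
    have ind: "\<exists>\<tau>. irreducible_fmat_rep (unit_group A U\<lparr>carrier := one_plus A S\<rparr>) \<tau> \<and>
      (\<forall>g\<in>carrier (unit_group A U).
        ftrace (\<sigma> g) = induced_character (unit_group A U) (one_plus A S) (\<lambda>h. ftrace (\<tau> h)) g)"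
    proof (rule G.irreducible_fmat_rep_induced[OF finG less.prems(4), of N])
      show "N \<subseteq> carrier (unit_group A U)" using NU by simp
      show "\<sigma> x * \<sigma> z = \<sigma> z * \<sigma> x" if "x \<in> N" "z \<in> N" for x z
        using that comm tyS by (auto simp: N_def)
      show "subgroup (one_plus A S) (unit_group A U)"
        by (rule subgroup_unit_group[OF nilU nilS SU finU])
      show "\<sigma> h * \<sigma> n = \<sigma> n * \<sigma> h" if "h \<in> one_plus A S" "n \<in> N" for h n
        using that comm by (auto simp: N_def elim!: one_plus_E)
      fix x assume "x \<in> carrier (unit_group A U)" "x \<notin> one_plus A S"
      then obtain u where u: "u \<in> U" "x = \<one>\<^bsub>A\<^esub> \<oplus>\<^bsub>A\<^esub> u" "u \<notin> S"
        by (auto elim!: one_plus_E intro: one_plus_I)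
      \<comment> \<open>The parameter that witnesses \<open>u \<notin> S\<close> supplies the
        element of \<open>N\<close>, and the pairing value is the scalar different from one.\<close>
      then obtain t where t: "t \<in> carrier F" "S.pairing u (t \<odot>\<^bsub>A\<^esub> y) \<noteq> 1"
        by (auto simp: S_def)
      then show "\<exists>n\<in>N. \<exists>c. c \<noteq> 1 \<and> \<sigma> x * \<sigma> n = c \<cdot>\<^sub>f (\<sigma> n * \<sigma> x)"
        using S.\<sigma>_commutator[OF u(1) tyB[OF t(1)]] unfolding u(2) N_def by blast
    qed
    then obtain \<tau> where \<tau>: "irreducible_fmat_rep (unit_group A S) \<tau>"
      and tr: "\<And>g. g \<in> one_plus A U \<Longrightarrow>
        ftrace (\<sigma> g) = induced_character (unit_group A U) (one_plus A S) (\<lambda>h. ftrace (\<tau> h)) g"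
      by auto
    have finS: "finite S" using SU finU finite_subset by blast
    obtain V \<phi> where V: "V \<subseteq> S" "nilpotent_subring A V" "\<forall>c\<in>carrier F. \<forall>v\<in>V. c \<odot>\<^bsub>A\<^esub> v \<in> V"
      and \<phi>: "\<forall>x\<in>one_plus A V. \<forall>y\<in>one_plus A V. \<phi> (x \<otimes>\<^bsub>A\<^esub> y) = \<phi> x * \<phi> y" "\<phi> \<one>\<^bsub>A\<^esub> = 1"
      and trS: "\<And>g. g \<in> one_plus A S \<Longrightarrow>
        ftrace (\<tau> g) = induced_character (unit_group A S) (one_plus A V) \<phi> g"
      using less.hyps[OF cardS nilS finS smS \<tau>] by blast
    have "ftrace (\<sigma> g) = induced_character (unit_group A U) (one_plus A V) \<phi> g" if g: "g \<in> one_plus A U" for g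
    proof -
      have "ftrace (\<sigma> g) = induced_character (unit_group A U) (one_plus A S)
          (induced_character (unit_group A U\<lparr>carrier := one_plus A S\<rparr>) (one_plus A V) \<phi>) g"
        unfolding tr[OF g] by (rule G.induced_character_cong) (simp add: trS)
      also have "\<dots> = induced_character (unit_group A U) (one_plus A V) \<phi> g"
        by (rule G.induced_character_trans[OF finG])
          (use subgroup_unit_group[OF nilU nilS SU finU] one_plus_mono[OF V(1)] g in auto)
      finally show ?thesis .
    qed
    then show ?thesis using V SU \<phi> by (intro exI[of _ V] exI[of _ \<phi>]) blast
  qed
qed

section \<open>The Jacobson radical of a finite ring\<close>

text \<open>Negatives come for free, as multiples by \<open>\<ominus> \<one>\<close>.\<close>

lemma left_ideal_iff:
  fixes R (structure)
  assumes "ring R"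
  shows "left_ideal I R \<longleftrightarrow> I \<subseteq> carrier R \<and> \<zero>\<^bsub>R\<^esub> \<in> I \<and> (\<forall>a\<in>I. \<forall>b\<in>I. a \<oplus>\<^bsub>R\<^esub> b \<in> I) \<and>
    (\<forall>x\<in>carrier R. \<forall>a\<in>I. x \<otimes>\<^bsub>R\<^esub> a \<in> I)" (is "_ = ?P")
proof
  assume "left_ideal I R"
  then interpret I: left_ideal I R .
  show ?P using I.a_subset I.mult_closed by (auto intro: I.a_closed)
next
  interpret ring R by fact
  assume P: ?P
  have "additive_subgroup I R"
  proof (intro additive_subgroup.intro add.subgroupI)
    show "I \<subseteq> carrier R" "I \<noteq> {}" using P by auto
    fix a assume a: "a \<in> I"
    then have ac: "a \<in> carrier R" using P by blast
    have "(\<ominus> \<one>) \<otimes> a \<in> I" using a P by simp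
    then show "\<ominus> a \<in> I" using ac by (simp add: l_minus)
    show "a \<oplus> b \<in> I" if "b \<in> I" for b using a that P by blast
  qed
  then show "left_ideal I R"
    using P assms unfolding left_ideal_def left_ideal_axioms_def by blast
qed

context ring
begin

lemma jacobson_radical_left_ideal: "left_ideal (jacobson_radical R) R"
proof -
  have "left_ideal M R" if "maximal_left_ideal M R" for M
    using that by (simp add: maximal_left_ideal_def)
  then show ?thesis
    unfolding left_ideal_iff[OF ring_axioms] jacobson_radical_def by auto
qed

text \<open>This set is the annihilator of the class of \<open>l\<close> in the simple module
  \<open>L\<close> modulo \<open>M\<close>. For a strictly larger left ideal \<open>I\<close>, the
  left ideal \<open>I l + M\<close> must be \<open>L\<close>, so \<open>l = r l + m\<close> with
  \<open>r\<close> in \<open>I\<close>. Then \<open>1 - r\<close> annihilates the class of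
  \<open>l\<close> and lies in \<open>I\<close>, and so does \<open>1\<close>.\<close>

lemma maximal_left_ideal_annihilator:
  assumes L: "left_ideal L R" and M: "left_ideal M R" and "M \<subseteq> L"
    and max: "\<And>K. left_ideal K R \<Longrightarrow> M \<subseteq> K \<Longrightarrow> K \<subseteq> L \<Longrightarrow> K = M \<or> K = L"
    and l: "l \<in> L" "l \<notin> M"
  shows "maximal_left_ideal {r \<in> carrier R. r \<otimes> l \<in> M} R"
proof -
  note iff = left_ideal_iff[OF ring_axioms]
  have L': "L \<subseteq> carrier R" "\<zero> \<in> L" "\<And>a b. a \<in> L \<Longrightarrow> b \<in> L \<Longrightarrow> a \<oplus> b \<in> L"
    "\<And>x a. x \<in> carrier R \<Longrightarrow> a \<in> L \<Longrightarrow> x \<otimes> a \<in> L"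
    using L unfolding iff by blast+
  have M': "M \<subseteq> carrier R" "\<zero> \<in> M" "\<And>a b. a \<in> M \<Longrightarrow> b \<in> M \<Longrightarrow> a \<oplus> b \<in> M"
    "\<And>x a. x \<in> carrier R \<Longrightarrow> a \<in> M \<Longrightarrow> x \<otimes> a \<in> M"
    using M unfolding iff by blast+
  have lc: "l \<in> carrier R" using l L' by blast
  have Mc: "m \<in> carrier R" if "m \<in> M" for m using that M' by blast
  let ?I = "{r \<in> carrier R. r \<otimes> l \<in> M}"
  show ?thesis unfolding maximal_left_ideal_def
  proof (intro conjI allI impI)
    show "left_ideal ?I R"
      unfolding iff using lc M' by (auto simp: l_distr m_assoc)
    have "\<one> \<notin> ?I" using l lc by simp
    then show "?I \<noteq> carrier R" by blast
    fix I assume I: "left_ideal I R \<and> ?I \<subseteq> I"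
    then have I': "I \<subseteq> carrier R" "\<zero> \<in> I" "\<And>a b. a \<in> I \<Longrightarrow> b \<in> I \<Longrightarrow> a \<oplus> b \<in> I"
      "\<And>x a. x \<in> carrier R \<Longrightarrow> a \<in> I \<Longrightarrow> x \<otimes> a \<in> I"
      unfolding iff by blast+
    have Ic: "i \<in> carrier R" if "i \<in> I" for i using that I' by blast
    show "I = ?I \<or> I = carrier R"
    proof (cases "I = ?I")
      case False
      then obtain i where i: "i \<in> I" "i \<otimes> l \<notin> M" using I I'(1) by blast
      define K where "K = {r \<otimes> l \<oplus> m | r m. r \<in> I \<and> m \<in> M}"
      have KI: "r \<otimes> l \<oplus> m \<in> K" if "r \<in> I" "m \<in> M" for r m
        using that by (auto simp: K_def)
      have "left_ideal K R"
        unfolding iff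
      proof (intro conjI ballI)
        show "K \<subseteq> carrier R" using lc Ic Mc by (auto simp: K_def)
        show "\<zero> \<in> K" using KI[OF I'(2) M'(2)] lc by simp
        fix a assume "a \<in> K"
        then obtain r m where a: "a = r \<otimes> l \<oplus> m" "r \<in> I" "m \<in> M" by (auto simp: K_def)
        show "a \<oplus> b \<in> K" if "b \<in> K" for b
        proof -
          obtain s n where b: "b = s \<otimes> l \<oplus> n" "s \<in> I" "n \<in> M"
            using \<open>b \<in> K\<close> by (auto simp: K_def)
          have "a \<oplus> b = (r \<oplus> s) \<otimes> l \<oplus> (m \<oplus> n)"
            using a b lc Ic Mc by (simp add: l_distr a_ac)
          then show ?thesis using KI[of "r \<oplus> s" "m \<oplus> n"] a b I' M' by simp
        qed
      next
        fix x a assume x: "x \<in> carrier R" and "a \<in> K"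
        then obtain r m where a: "a = r \<otimes> l \<oplus> m" "r \<in> I" "m \<in> M" by (auto simp: K_def)
        have "x \<otimes> a = (x \<otimes> r) \<otimes> l \<oplus> x \<otimes> m"
          using a x lc Ic Mc by (simp add: r_distr m_assoc)
        then show "x \<otimes> a \<in> K" using KI[of "x \<otimes> r" "x \<otimes> m"] a x I' M' by simp
      qed
      moreover have "M \<subseteq> K"
      proof
        fix m assume "m \<in> M"
        then show "m \<in> K" using KI[OF I'(2), of m] lc Mc by simp
      qed
      moreover have "K \<subseteq> L"
        using \<open>M \<subseteq> L\<close> l(1) L' Ic by (auto simp: K_def)
      moreover have "i \<otimes> l \<in> K" using KI[OF i(1) M'(2)] lc Ic[OF i(1)] by simp
      ultimately have "K = L" using max i(2) by blast
      then obtain r m where rm: "l = r \<otimes> l \<oplus> m" "r \<in> I" "m \<in> M"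
        using l(1) by (auto simp: K_def)
      have "(\<one> \<oplus> \<ominus> r) \<otimes> l = l \<oplus> \<ominus> (r \<otimes> l)"
        using rm(2) lc Ic by (simp add: l_distr l_minus)
      also have "\<dots> = (r \<otimes> l \<oplus> m) \<oplus> \<ominus> (r \<otimes> l)"
        using rm(1) by simp
      also have "\<dots> = m"
        using rm(2,3) lc Ic Mc by (simp add: a_ac r_neg r_neg1)
      finally have "\<one> \<oplus> \<ominus> r \<in> ?I" using rm Ic by simp
      then have "\<one> \<oplus> \<ominus> r \<in> I" using I by blast
      then have "(\<one> \<oplus> \<ominus> r) \<oplus> r \<in> I" using I'(3) rm(2) by blast
      then have one: "\<one> \<in> I" using Ic[OF rm(2)] by (simp add: a_assoc l_neg)
      have "x \<in> I" if "x \<in> carrier R" for x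
        using I'(4)[OF that one] that by simp
      then show ?thesis using I'(1) by blast
    qed simp
  qed
qed

text \<open>Nakayama: \<open>J\<close> maps a left ideal into each of its maximal proper left subideals.\<close>

lemma jacobson_radical_annihilates:
  assumes fin: "finite (carrier R)" and L: "left_ideal L R"
  shows "\<exists>k. \<forall>x\<in>products R (jacobson_radical R) k. \<forall>l\<in>L. x \<otimes> l = \<zero>"
  using L
proof (induction "card L" arbitrary: L rule: less_induct)
  case less
  note iff = left_ideal_iff[OF ring_axioms]
  have Jc: "jacobson_radical R \<subseteq> carrier R" by (auto simp: jacobson_radical_def)
  have pc: "products R (jacobson_radical R) k \<subseteq> carrier R" for k
    by (induction k) (use Jc in auto)
  have Lc: "L \<subseteq> carrier R" and L0: "\<zero> \<in> L" using less.prems unfolding iff by blast+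
  have finL: "finite L" using Lc fin finite_subset by blast
  show ?case
  proof (cases "L = {\<zero>}")
    case True
    then show ?thesis using Jc by (intro exI[of _ 0]) auto
  next
    case False
    have "finite {M. left_ideal M R \<and> M \<subset> L}"
      by (rule finite_subset[of _ "Pow L"]) (use finL in auto)
    moreover have "left_ideal {\<zero>} R" unfolding iff by auto
    then have "{M. left_ideal M R \<and> M \<subset> L} \<noteq> {}" using False L0 by blast
    ultimately obtain M where "M \<in> {M. left_ideal M R \<and> M \<subset> L}"
      and "\<forall>K\<in>{M. left_ideal M R \<and> M \<subset> L}. M \<subseteq> K \<longrightarrow> M = K"
      by (rule finite_has_maximal[THEN bexE])
    then have M: "left_ideal M R" "M \<subset> L"
      and max: "\<And>K. left_ideal K R \<Longrightarrow> K \<subset> L \<Longrightarrow> M \<subseteq> K \<Longrightarrow> M = K"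
      by simp_all
    have MJ: "x \<otimes> l \<in> M" if "x \<in> carrier R" "l \<in> M" for x l
      using M(1) that by (simp add: iff)
    have JL: "j \<otimes> l \<in> M" if j: "j \<in> jacobson_radical R" and l: "l \<in> L" for j l
    proof (cases "l \<in> M")
      case True
      then show ?thesis using MJ j Jc by blast
    next
      case False
      have "maximal_left_ideal {r \<in> carrier R. r \<otimes> l \<in> M} R"
      proof (rule maximal_left_ideal_annihilator[OF less.prems M(1) _ _ l False])
        show "M \<subseteq> L" using M(2) by blast
        show "K = M \<or> K = L" if "left_ideal K R" "M \<subseteq> K" "K \<subseteq> L" for K
          using max[of K] that by blast
      qed
      then show ?thesis using j unfolding jacobson_radical_def by blast
    qed
    have "card M < card L" using M(2) finL by (rule psubset_card_mono[rotated])
    then obtain k where k: "\<forall>x\<in>products R (jacobson_radical R) k. \<forall>l\<in>M. x \<otimes> l = \<zero>"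
      using less.hyps M(1) by blast
    \<comment> \<open>The rightmost factor acts first: \<open>u\<close> takes \<open>L\<close> into
      \<open>M\<close>, and \<open>x\<close> kills \<open>M\<close> by the induction
      hypothesis.\<close>
    have "x \<otimes> u \<otimes> l = \<zero>" if "x \<in> products R (jacobson_radical R) k" "u \<in> jacobson_radical R" "l \<in> L" for x u l
    proof -
      have "x \<otimes> u \<otimes> l = x \<otimes> (u \<otimes> l)"
        using that pc[of k] Jc Lc by (intro m_assoc) auto
      then show ?thesis using k JL that by simp
    qed
    then show ?thesis by (intro exI[of _ "Suc k"]) auto
  qed
qed

text \<open>Long products in the radical annihilate the whole ring by Nakayama; applied to
  \<open>\<one>\<close> this says that they vanish.\<close>

lemma nilpotent_jacobson_radical:
  assumes fin: "finite (carrier R)"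
  shows "nilpotent_subring R (jacobson_radical R)"
proof -
  let ?J = "jacobson_radical R"
  note iff = left_ideal_iff[OF ring_axioms]
  have J: "?J \<subseteq> carrier R" "\<zero> \<in> ?J" "\<And>a b. a \<in> ?J \<Longrightarrow> b \<in> ?J \<Longrightarrow> a \<oplus> b \<in> ?J"
    "\<And>x a. x \<in> carrier R \<Longrightarrow> a \<in> ?J \<Longrightarrow> x \<otimes> a \<in> ?J"
    using jacobson_radical_left_ideal unfolding iff by blast+
  have "left_ideal (carrier R) R" unfolding iff by auto
  then obtain k where k: "\<forall>x\<in>products R ?J k. \<forall>l\<in>carrier R. x \<otimes> l = \<zero>"
    using jacobson_radical_annihilates[OF fin] by blast
  have pc: "products R ?J k \<subseteq> carrier R" for k
    by (induction k) (use J in auto)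
  have "x = \<zero>" if "x \<in> products R ?J k" for x
    using k that pc[of k] by (metis one_closed r_one subsetD)
  moreover have "\<ominus> u \<in> ?J" if "u \<in> ?J" for u
  proof -
    have "(\<ominus> \<one>) \<otimes> u \<in> ?J" using J(4) that by simp
    moreover have "u \<in> carrier R" using that J(1) by blast
    ultimately show ?thesis by (simp add: l_minus)
  qed
  ultimately show ?thesis
    unfolding nilpotent_subring_def using J by blast
qed

end

text \<open>Every vector is a combination of a finite spanning set. Restricting coefficient
  functions to that set leaves finitely many of them.\<close>

lemma (in vectorspace) finite_carrier:
  assumes "finite (carrier K)" "fin_dim"
  shows "finite (carrier V)"
proof -
  obtain X where X: "finite X" "X \<subseteq> carrier V" "span X = carrier V"
    using assms(2) unfolding fin_dim_def by blast
  have "carrier V \<subseteq> (\<lambda>a. lincomb a X) ` (X \<rightarrow>\<^sub>E carrier K)"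
  proof
    fix v assume "v \<in> carrier V"
    then obtain a where a: "a \<in> X \<rightarrow> carrier K" "v = lincomb a X"
      using finite_span[OF X(1,2)] X(3) by auto
    have "lincomb (restrict a X) X = lincomb a X"
      unfolding lincomb_def using a X by (intro finsum_cong) (auto simp: Pi_def)
    moreover have "restrict a X \<in> X \<rightarrow>\<^sub>E carrier K" using a(1) by auto
    ultimately show "v \<in> (\<lambda>a. lincomb a X) ` (X \<rightarrow>\<^sub>E carrier K)" using a(2) by (metis imageI)
  qed
  then show ?thesis
    using finite_PiE[OF X(1), of "\<lambda>_. carrier K"] assms(1) finite_subset by blast
qed

section \<open>Matrix representations\<close>

lift_definition fmat_of_mat :: "complex mat \<Rightarrow> fmat" is
  "\<lambda>M i j. if i < dim_row M \<and> j < dim_col M then M $$ (i, j) else 0"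
proof -
  fix M :: "complex mat"
  have "mat_bound (max (dim_row M) (dim_col M))
      (\<lambda>i j. if i < dim_row M \<and> j < dim_col M then M $$ (i, j) else 0)"
    by (auto simp: mat_bound_def)
  then show "\<exists>n. mat_bound n (\<lambda>i j. if i < dim_row M \<and> j < dim_col M then M $$ (i, j) else 0)" ..
qed

lemma entry_fmat_of_mat:
  "M \<in> carrier_mat n m \<Longrightarrow> entry (fmat_of_mat M) i j = (if i < n \<and> j < m then M $$ (i, j) else 0)"
  by (auto simp: fmat_of_mat.rep_eq)

lemma mat_bound_fmat_of_mat: "M \<in> carrier_mat n n \<Longrightarrow> mat_bound n (entry (fmat_of_mat M))"
  by (auto simp: mat_bound_def entry_fmat_of_mat)

lemma fmat_of_mat_mult:
  assumes M: "M \<in> carrier_mat n n" and N: "N \<in> carrier_mat n n"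
  shows "fmat_of_mat (M * N) = fmat_of_mat M * fmat_of_mat N"
proof (rule fmat_eqI)
  fix i j
  have "entry (fmat_of_mat M * fmat_of_mat N) i j
      = (\<Sum>k<n. entry (fmat_of_mat M) i k * entry (fmat_of_mat N) k j)"
    using mat_bound_fmat_of_mat[OF M] by (intro entry_times) blast
  also have "\<dots> = entry (fmat_of_mat (M * N)) i j"
    using M N by (subst entry_fmat_of_mat[of "M * N" n n])
      (auto simp: entry_fmat_of_mat[OF M] entry_fmat_of_mat[OF N] scalar_prod_def lessThan_atLeast0)
  finally show "entry (fmat_of_mat (M * N)) i j = entry (fmat_of_mat M * fmat_of_mat N) i j" ..
qed

lemma fmat_of_mat_inj:
  assumes "M \<in> carrier_mat n m" "N \<in> carrier_mat n m" "fmat_of_mat M = fmat_of_mat N"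
  shows "M = N"
proof (rule eq_matI)
  fix i j assume "i < dim_row N" "j < dim_col N"
  then show "M $$ (i, j) = N $$ (i, j)"
    using entry_fmat_of_mat[OF assms(1), of i j] entry_fmat_of_mat[OF assms(2), of i j] assms by simp
qed (use assms in auto)

lemma fmat_of_mat_smult: "fmat_of_mat (c \<cdot>\<^sub>m M) = c \<cdot>\<^sub>f fmat_of_mat M"
  by (rule fmat_eqI) (simp add: fmat_of_mat.rep_eq fscale.rep_eq)

lemma ftrace_fmat_of_mat:
  assumes M: "M \<in> carrier_mat n n"
  shows "ftrace (fmat_of_mat M) = mat_trace M"
  using M by (subst ftrace_bound[OF mat_bound_fmat_of_mat[OF M]])
    (simp add: entry_fmat_of_mat[OF M] mat_trace_def)

lemma fmat_of_mat_surj: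
  assumes "mat_bound n (entry x)"
  shows "\<exists>M\<in>carrier_mat n n. fmat_of_mat M = x"
proof (intro bexI fmat_eqI)
  show "entry (fmat_of_mat (mat n n (\<lambda>(i, j). entry x i j))) i j = entry x i j" for i j
    using assms by (auto simp: fmat_of_mat.rep_eq mat_bound_def)
qed simp

lemma complex_mat_eigenvector:
  assumes M: "(M :: complex mat) \<in> carrier_mat n n" and "n > 0"
  obtains v c where "v \<in> carrier_vec n" "v \<noteq> 0\<^sub>v n" "M *\<^sub>v v = c \<cdot>\<^sub>v v"
proof -
  have "degree (char_poly M) \<noteq> 0" using degree_monic_char_poly[OF M] \<open>n > 0\<close> by simp
  then obtain c where "poly (char_poly M) c = 0"
    using fundamental_theorem_of_algebra[of "char_poly M"] by (auto simp: constant_degree)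
  then have "eigenvalue M c" using eigenvalue_root_char_poly[OF M] by simp
  then show thesis using that M by (auto simp: eigenvalue_def eigenvector_def)
qed

text \<open>Schur's lemma: a matrix commuting with the representation has an eigenvalue, its
  eigenspace is invariant and nonzero, hence the whole space.\<close>

lemma (in group) irreducible_fmat_rep_of_representation:
  assumes "irreducible_representation G n \<rho>"
  shows "irreducible_fmat_rep G (\<lambda>g. fmat_of_mat (\<rho> g))"
proof -
  let ?R = "ring_mat TYPE(complex) n ()"
  interpret R: ring ?R by (rule ring_mat)
  have hom: "\<rho> \<in> hom G (GL n)" and n: "n > 0"
    and irr: "\<And>W. VectorSpace.subspace class_ring W (module_vec TYPE(complex) n) \<Longrightarrow>
      (\<And>g w. g \<in> carrier G \<Longrightarrow> w \<in> W \<Longrightarrow> \<rho> g *\<^sub>v w \<in> W) \<Longrightarrow> W = {0\<^sub>v n} \<or> W = carrier_vec n"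
    using assms unfolding irreducible_representation_def representation_def by blast+
  have \<rho>: "\<rho> g \<in> carrier_mat n n" if "g \<in> carrier G" for g
    using hom that by (auto simp: hom_def Pi_def GL_def units_of_def Units_def ring_mat_def)
  have mult: "\<rho> (x \<otimes> y) = \<rho> x * \<rho> y" if "x \<in> carrier G" "y \<in> carrier G" for x y
    using hom_mult[OF hom that] by (simp add: GL_def units_of_def ring_mat_def)
  have "\<rho> \<one> = \<one>\<^bsub>GL n\<^esub>"
    using hom_one[OF hom group_axioms] R.units_group by (simp add: GL_def)
  then have one: "\<rho> \<one> = 1\<^sub>m n"
    by (simp add: GL_def units_of_def ring_mat_def)
  show ?thesis unfolding irreducible_fmat_rep_def
  proof (intro conjI ballI allI impI)
    show "fmat_of_mat (\<rho> (x \<otimes> y)) = fmat_of_mat (\<rho> x) * fmat_of_mat (\<rho> y)"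
      if "x \<in> carrier G" "y \<in> carrier G" for x y
      using that by (simp add: mult fmat_of_mat_mult[OF \<rho> \<rho>])
    have "entry (fmat_of_mat (\<rho> \<one>)) 0 0 = 1"
      using n by (simp add: one fmat_of_mat.rep_eq)
    then show "fmat_of_mat (\<rho> \<one>) \<noteq> 0" by (auto simp: zero_fmat.rep_eq)
    fix X assume X: "fmat_of_mat (\<rho> \<one>) * X * fmat_of_mat (\<rho> \<one>) = X"
      and comm: "\<forall>g\<in>carrier G. X * fmat_of_mat (\<rho> g) = fmat_of_mat (\<rho> g) * X"
    let ?e = "fmat_of_mat (\<rho> \<one>)"
    have e: "mat_bound n (entry ?e)" using mat_bound_fmat_of_mat[OF \<rho>] by simp
    have "mat_bound n (entry X)"
    proof -
      \<comment> \<open>Nothing is known yet about the size of \<open>X\<close>, so it is read off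
        from \<open>X = e X e\<close>: the left factor bounds the rows, the right factor the
        columns.\<close>
      have "entry (?e * (X * ?e)) i j = 0" if "n \<le> i" for i j
        using e that by (subst entry_times[OF disjI1[OF e]]) (auto simp: mat_bound_def)
      moreover have "entry ((?e * X) * ?e) i j = 0" if "n \<le> j" for i j
        using e that by (subst entry_times[OF disjI2[OF e]]) (auto simp: mat_bound_def)
      ultimately show ?thesis using X by (auto simp: mat_bound_def mult.assoc)
    qed
    then obtain M where M: "M \<in> carrier_mat n n" "fmat_of_mat M = X"
      using fmat_of_mat_surj by blast
    have Mcomm: "M * \<rho> g = \<rho> g * M" if g: "g \<in> carrier G" for g
    proof (rule fmat_of_mat_inj)
      show "fmat_of_mat (M * \<rho> g) = fmat_of_mat (\<rho> g * M)"
        using comm g M by (simp add: fmat_of_mat_mult[OF M(1) \<rho>] fmat_of_mat_mult[OF \<rho> M(1)])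
    qed (use M(1) \<rho>[OF g] in auto)
    obtain v c where v: "v \<in> carrier_vec n" "v \<noteq> 0\<^sub>v n" "M *\<^sub>v v = c \<cdot>\<^sub>v v"
      using complex_mat_eigenvector[OF M(1) n] .
    define W where "W = {w \<in> carrier_vec n. M *\<^sub>v w = c \<cdot>\<^sub>v w}"
    have "W = {0\<^sub>v n} \<or> W = carrier_vec n"
    proof (rule irr)
      have "submodule class_ring W (module_vec TYPE(complex) n)"
      proof (rule submodule.intro)
        show "Module.module class_ring (module_vec TYPE(complex) n)" by (rule vec_module)
      qed (use M(1) in \<open>auto simp: W_def module_vec_simps mult_add_distrib_mat_vec smult_add_distrib_vec
          mult_mat_vec smult_smult_assoc mult.commute\<close>)
      then show "VectorSpace.subspace class_ring W (module_vec TYPE(complex) n)"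
        by (intro VectorSpace.subspace.intro vec_vs)
      fix g w assume g: "g \<in> carrier G" and w: "w \<in> W"
      have w': "w \<in> carrier_vec n" "M *\<^sub>v w = c \<cdot>\<^sub>v w" using w by (auto simp: W_def)
      have "M *\<^sub>v (\<rho> g *\<^sub>v w) = (M * \<rho> g) *\<^sub>v w"
        using M(1) \<rho>[OF g] w'(1) by (intro assoc_mult_mat_vec[symmetric])
      also have "\<dots> = \<rho> g *\<^sub>v (M *\<^sub>v w)"
        unfolding Mcomm[OF g] using M(1) \<rho>[OF g] w'(1) by (intro assoc_mult_mat_vec)
      also have "\<dots> = c \<cdot>\<^sub>v (\<rho> g *\<^sub>v w)"
        unfolding w'(2) using \<rho>[OF g] w'(1) by (intro mult_mat_vec)
      finally show "\<rho> g *\<^sub>v w \<in> W"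
        using \<rho>[OF g] w'(1) by (simp add: W_def)
    qed
    moreover have "v \<in> W" using v by (simp add: W_def)
    ultimately have W: "W = carrier_vec n" using v by blast
    have "M = c \<cdot>\<^sub>m 1\<^sub>m n"
    proof (rule eq_matI)
      fix i j assume ij: "i < dim_row (c \<cdot>\<^sub>m 1\<^sub>m n)" "j < dim_col (c \<cdot>\<^sub>m 1\<^sub>m n)"
      then have ij': "i < n" "j < n" by auto
      have "unit_vec n j \<in> W" by (simp add: W)
      then have "(M *\<^sub>v unit_vec n j) $ i = (c \<cdot>\<^sub>v unit_vec n j) $ i" by (simp add: W_def)
      then show "M $$ (i, j) = (c \<cdot>\<^sub>m 1\<^sub>m n) $$ (i, j)"
        using ij' M(1) by (simp split: if_splits)
    qed (use M(1) in auto)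
    then have "X = c \<cdot>\<^sub>f ?e" using M(2) by (simp add: one fmat_of_mat_smult)
    then show "\<exists>c. X = c \<cdot>\<^sub>f ?e" ..
  qed
qed

text \<open>The values are viewed as matrices of size one; \<open>\<phi>\<close> at the inverse
  element makes them invertible.\<close>

lemma linear_characterI:
  assumes "group H" and mult: "\<And>x y. x \<in> carrier H \<Longrightarrow> y \<in> carrier H \<Longrightarrow> \<phi> (x \<otimes>\<^bsub>H\<^esub> y) = \<phi> x * \<phi> y"
    and one: "\<phi> \<one>\<^bsub>H\<^esub> = 1"
  shows "linear_character H \<phi>"
proof -
  interpret group H by fact
  define \<rho> where "\<rho> g = \<phi> g \<cdot>\<^sub>m 1\<^sub>m 1" for g
  have m: "\<rho> x * \<rho> y = \<rho> (x \<otimes>\<^bsub>H\<^esub> y)" if "x \<in> carrier H" "y \<in> carrier H" for x y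
    using that by (intro eq_matI) (auto simp: \<rho>_def mult scalar_prod_def)
  have "\<rho> \<one>\<^bsub>H\<^esub> = 1\<^sub>m 1" by (intro eq_matI) (auto simp: \<rho>_def one)
  then have "\<rho> x * \<rho> (inv\<^bsub>H\<^esub> x) = 1\<^sub>m 1" "\<rho> (inv\<^bsub>H\<^esub> x) * \<rho> x = 1\<^sub>m 1" if "x \<in> carrier H" for x
    using that by (simp_all add: m)
  moreover have "\<rho> x \<in> carrier_mat 1 1" for x by (simp add: \<rho>_def)
  ultimately have "\<rho> x \<in> Units (ring_mat TYPE(complex) 1 ())" if "x \<in> carrier H" for x
    unfolding Units_def ring_mat_def using that by (auto intro!: bexI[of _ "\<rho> (inv\<^bsub>H\<^esub> x)"])
  then have "\<rho> \<in> hom H (GL 1)"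
    unfolding hom_def GL_def units_of_def by (simp add: m ring_mat_def)
  moreover have "\<phi> g = mat_trace (\<rho> g)" for g by (simp add: \<rho>_def mat_trace_def)
  ultimately show ?thesis
    unfolding linear_character_def representation_def affords_def by blast
qed

section \<open>Conclusion for the group of the Jacobson radical\<close>

theorem theorem1p1:
  fixes p e q :: nat
    and F :: "('k, 'm) ring_scheme"
    and A :: "('k, 'a, 'n) module_scheme"
    and \<chi> :: "'a \<Rightarrow> complex"
  assumes "prime p" and "e \<ge> 1" and "q = p ^ e"
    and "field F" and "finite (carrier F)" and "card (carrier F) = q"
    and "fin_dim_algebra F A"
    and "irreducible_character (algebra_group A) \<chi>"
  shows "\<exists>H \<phi>. algebra_subgroup F A H \<and>
           linear_character ((algebra_group A)\<lparr>carrier := H\<rparr>) \<phi> \<and>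
           (\<forall>g\<in>carrier (algebra_group A).
              \<chi> g = induced_character (algebra_group A) H \<phi> g)"
proof -
  interpret fin_dim_algebra F A by fact
  define J where "J = jacobson_radical A"
  have AG: "algebra_group A = unit_group A J"
    by (simp add: algebra_group_def unit_group_def J_def)
  have finA: "finite (carrier A)"
    using finite_carrier[OF \<open>finite (carrier F)\<close> finite_dimensional] .
  have J: "nilpotent_subring A J"
    unfolding J_def using finA by (rule nilpotent_jacobson_radical)
  have JA: "J \<subseteq> carrier A" using nilpotent_subringD(1)[OF J] .
  have finJ: "finite J" using JA finA finite_subset by blast
  have smJ: "c \<odot>\<^bsub>A\<^esub> u \<in> J" if "c \<in> carrier F" "u \<in> J" for c u
  proof -
    have u: "u \<in> carrier A" using that JA by blast
    have "(c \<odot>\<^bsub>A\<^esub> \<one>\<^bsub>A\<^esub>) \<otimes>\<^bsub>A\<^esub> u \<in> J"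
      using jacobson_radical_left_ideal that unfolding left_ideal_iff[OF ring_axioms] J_def by simp
    then show ?thesis using that u by (simp add: smult_mult_left)
  qed
  interpret G: group "unit_group A J" using J finJ by (rule group_unit_group)
  obtain n \<rho> where \<rho>: "irreducible_representation (unit_group A J) n \<rho>"
    and \<chi>: "\<And>g. g \<in> one_plus A J \<Longrightarrow> \<chi> g = mat_trace (\<rho> g)"
    using assms(8) unfolding irreducible_character_def affords_def AG by auto
  obtain V \<phi> where V: "V \<subseteq> J" "nilpotent_subring A V" "\<forall>c\<in>carrier F. \<forall>v\<in>V. c \<odot>\<^bsub>A\<^esub> v \<in> V"
    and \<phi>: "\<forall>x\<in>one_plus A V. \<forall>y\<in>one_plus A V. \<phi> (x \<otimes>\<^bsub>A\<^esub> y) = \<phi> x * \<phi> y" "\<phi> \<one>\<^bsub>A\<^esub> = 1"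
    and ind: "\<And>g. g \<in> one_plus A J \<Longrightarrow>
      ftrace (fmat_of_mat (\<rho> g)) = induced_character (unit_group A J) (one_plus A V) \<phi> g"
    using irreducible_fmat_rep_monomial[OF J finJ smJ G.irreducible_fmat_rep_of_representation[OF \<rho>]]
    by blast
  note VD = nilpotent_subringD[OF V(2)]
  have finV: "finite V" using V(1) finJ finite_subset by blast
  have "algebra_subgroup F A (one_plus A V)"
    unfolding algebra_subgroup_def AG J_def[symmetric]
  proof (intro conjI exI[of _ V])
    show "subgroup (one_plus A V) (unit_group A J)"
      by (rule subgroup_unit_group[OF J V(2) V(1) finJ])
    show "VectorSpace.subspace F V A"
      by (intro VectorSpace.subspace.intro submodule.intro vectorspace_axioms module_axioms) (use VD V in auto)
  qed (use V VD in auto)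
  moreover have "linear_character ((algebra_group A)\<lparr>carrier := one_plus A V\<rparr>) \<phi>"
    unfolding AG unit_group_simps
    by (rule linear_characterI) (use group_unit_group[OF V(2) finV] \<phi> in auto)
  moreover have "\<chi> g = induced_character (algebra_group A) (one_plus A V) \<phi> g"
    if "g \<in> carrier (algebra_group A)" for g
  proof -
    have g: "g \<in> one_plus A J" using that by (simp add: AG)
    have "\<rho> g \<in> carrier_mat n n"
      using \<rho> g unfolding irreducible_representation_def representation_def hom_def
      by (auto simp: GL_def units_of_def Units_def ring_mat_def)
    then show ?thesis using \<chi>[OF g] ind[OF g] by (simp add: ftrace_fmat_of_mat AG)
  qed
  ultimately show ?thesis by blast
qed

end
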